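(* Let $a,b,c$ be positive integers and $k$ a non-negative integer, and let $\ell=\min(k,a,c)$. Let $1\le a_1<a_2<\dots<a_\ell\le b+\min(k,a)$ be integers. Consider the lozenge tilings of the $a,b,c$ hexagon in which the vertical lozenges bisected by the $k$-th horizontal line from the top occur exactly at hexagonal positions $a_1,\dots,a_\ell$ (and nowhere else on that line). Writing $V(x_1,\dots,x_m)=\prod_{1\le i<j\le m}\frac{x_j-x_i}{j-i}$: (i) if $k<\min(a,c)$, the number of such tilings is $$V(a_1,\dots,a_\ell)\,V(1,2,\dots,a-k,\;a-k+a_1,\dots,a-k+a_\ell,\;a+b+1,\dots,a+b+c-k);$$ (ii) if $a\le c$ and $a\le k\le (a+c)/2$, the number of such tilings is $$V(1,2,\dots,k-a,\;k-a+a_1,\dots,k-a+a_\ell)\,V(a_1,\dots,a_\ell,\;a+b+1,\dots,a+b+c-k).$$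
   Context: A lozenge is a rhombus with unit sides and angles $\pi/3$ and $2\pi/3$, with vertices on the unit triangular lattice; a vertical lozenge is one whose long diagonal is vertical. The $a,b,c$ hexagon is the equiangular hexagon with side lengths $a,b,c,a,b,c$ in clockwise order starting from the upper-left side, so the horizontal sides have length $b$, the upper-left side length $a$ and the upper-right side length $c$. Horizontal lattice lines are numbered $k=0,1,2,\dots$ from the top, the top edge being $k=0$. A vertical lozenge is bisected by the $k$-th line if its horizontal diagonal lies on that line. The hexagonal position of such a lozenge is the horizontal distance (in units of the lozenge side length) from its right corner to the left boundary of the hexagon along that line. The product $V$ of an empty or one-element list is $1$; when $k-a=0$ the list $1,\dots,k-a$ is empty. *)

theory Defs
  imports "HOL-Analysis.Analysis"
begin

definition tri_lattice :: "complex set" where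
  "tri_lattice = {of_int m + of_int n * cis (pi / 3) | m n. True}"

text \<open>Corners of a unit rhombus, listed from an acute corner \<open>p\<close>; the two sides at \<open>p\<close> are
  \<open>u\<close> and its rotation by \<open>pi / 3\<close>.\<close>

definition rhombus_corners :: "complex \<Rightarrow> complex \<Rightarrow> complex set" where
  "rhombus_corners p u = {p, p + u, p + u + cis (pi / 3) * u, p + cis (pi / 3) * u}"

definition lozenges :: "complex set set" where
  "lozenges = {convex hull (rhombus_corners p u) | p u.
                 norm u = 1 \<and> rhombus_corners p u \<subseteq> tri_lattice}"

text \<open>The lozenge whose short diagonal is the horizontal segment from \<open>r - 1\<close> to its right
  corner \<open>r\<close>, so that its long diagonal is vertical.\<close>

definition vertical_lozenge :: "complex \<Rightarrow> complex set" where
  "vertical_lozenge r = convex hull {r, r + cis (2 * pi / 3), r - 1, r + cis (- 2 * pi / 3)}"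

text \<open>The upper left corner is the origin and the corners are listed clockwise; the successive
  sides, starting at the top one, have lengths \<open>b, c, a, b, c, a\<close>.\<close>

definition hexagon :: "nat \<Rightarrow> nat \<Rightarrow> nat \<Rightarrow> complex set" where
  "hexagon a b c = convex hull
     {0,
      of_nat b,
      of_nat b + of_nat c * cis (- pi / 3),
      of_nat b + of_nat c * cis (- pi / 3) + of_nat a * cis (- 2 * pi / 3),
      of_nat c * cis (- pi / 3) + of_nat a * cis (- 2 * pi / 3),
      of_nat a * cis (- 2 * pi / 3)}"

definition lozenge_tiling :: "complex set \<Rightarrow> complex set set \<Rightarrow> bool" where
  "lozenge_tiling R T \<longleftrightarrow>
     T \<subseteq> lozenges \<and> \<Union>T = R \<and> pairwise (\<lambda>L L'. interior L \<inter> interior L' = {}) T"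

text \<open>Imaginary part of the points of the \<open>k\<close>-th horizontal lattice line, counted from the top
  side of the hexagon.\<close>

definition line_height :: "nat \<Rightarrow> real" where
  "line_height k = - (real k * sqrt 3 / 2)"

definition left_boundary :: "nat \<Rightarrow> nat \<Rightarrow> nat \<Rightarrow> nat \<Rightarrow> real" where
  "left_boundary a b c k = Inf {x. Complex x (line_height k) \<in> hexagon a b c}"

definition vertical_positions ::
    "nat \<Rightarrow> nat \<Rightarrow> nat \<Rightarrow> nat \<Rightarrow> complex set set \<Rightarrow> real set" where
  "vertical_positions a b c k T =
     {Re r - left_boundary a b c k | r. vertical_lozenge r \<in> T \<and> Im r = line_height k}"

definition V :: "int list \<Rightarrow> real" where
  "V xs = (\<Prod>j<length xs. \<Prod>i<j. real_of_int (xs ! j - xs ! i) / (real j - real i))"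

end

theory Submission
  imports Defs "Jordan_Normal_Form.Determinant"
begin

text \<open>In each row of the hexagon, mark the unit segments of the upper boundary line that are not the
  diagonal of a vertical lozenge. Passing to the next line, the two other kinds of lozenges move
  each marked segment by a left or a right half step, so a tiling is the same thing as a family of
  \<open>b\<close> nonintersecting lattice paths that starts at the top side and ends at the bottom side.
  Cutting the paths at the \<open>k\<close>-th line splits the count into a product of two factors, which are
  interchanged by time reversal. For paths that start in \<open>b\<close> consecutive positions, the
  complements of the successive position sets interlace, so one factor counts Gelfand-Tsetlin
  patterns with prescribed last row. Writing \<open>V\<close> as a determinant of binomial coefficients, summation over
  an interlacing row is a columnwise telescoping sum, and induction gives the product formula.\<close>

section \<open>Summation over interlacing sequences\<close>

text \<open>Passing from paths to gaps makes one recursion suffice. From \<open>b\<close>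
  consecutive positions the window of reachable positions grows by one per line while the number of
  paths stays \<open>b\<close>, so after \<open>n\<close> steps there are exactly \<open>n\<close>
  gaps. The windows are those of the unconfined paths, \<open>{0..<b+k}\<close> for the part above
  line \<open>k\<close> and \<open>{k-a..<b+c}\<close> for the part below it, not the
  \<open>k\<close>-th line of the hexagon. The two end sets alone keep the paths inside the hexagon,
  so the window positions outside it are gaps in every configuration. They are the runs of
  consecutive integers among the arguments of \<open>V\<close>, and the two cases of the theorem
  differ only in the sides on which a window sticks out. Steps, interlacing and complements are all
  expressed by the counting function \<open>below\<close>, for which a complement is a subtraction.
  Lists are indexed only where interlacing has to be read as a product of intervals for the
  summation.\<close>

definition newton :: "(nat \<Rightarrow> real) \<Rightarrow> nat \<Rightarrow> real \<Rightarrow> real" where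
  "newton p l x = (\<Prod>i<l. x - p i)"

lemma newton_Suc: "newton p (Suc l) x = newton p l x * (x - p l)"
  by (simp add: newton_def)

lemma newton_eq_0: "i < l \<Longrightarrow> newton p l (p i) = 0"
  by (auto simp: newton_def)

lemma gbinomial_Suc_right: "(x::real) gchoose Suc j = (x gchoose j) * (x - real j) / real (Suc j)"
  by (simp add: gbinomial_prod_rev field_simps lessThan_Suc atLeast0LessThan)

text \<open>The factor \<open>x - j\<close> of the recursion is split as
  \<open>(x - p l) + (p l - j)\<close>: the first summand raises the Newton index, the second keeps
  it. Only the leading coefficient enters the determinants, so the others stay existential.\<close>

lemma gbinomial_newton:
  "\<exists>u. (\<forall>x. x gchoose j = (\<Sum>l\<le>j. u l * newton p l x)) \<and> u j = 1 / fact j"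
proof (induction j)
  case 0
  show ?case by (auto intro!: exI[of _ "\<lambda>_. 1"] simp: newton_def)
next
  case (Suc j)
  then obtain u where u: "\<And>x. x gchoose j = (\<Sum>l\<le>j. u l * newton p l x)" "u j = 1 / fact j"
    by blast
  define w where "w l = ((if l = 0 then 0 else u (l - 1)) + (if l \<le> j then u l * (p l - real j) else 0)) / real (Suc j)" for l
  have "x gchoose Suc j = (\<Sum>l\<le>Suc j. w l * newton p l x)" for x
  proof -
    have "(x gchoose Suc j) * real (Suc j) = (\<Sum>l\<le>j. u l * newton p l x) * (x - real j)"
      by (simp add: gbinomial_Suc_right u)
    also have "\<dots> = (\<Sum>l\<le>j. u l * newton p (Suc l) x + u l * (p l - real j) * newton p l x)"
      unfolding sum_distrib_right by (intro sum.cong) (auto simp: newton_Suc algebra_simps)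
    also have "\<dots> = (\<Sum>l\<le>Suc j. (if l = 0 then 0 else u (l - 1)) * newton p l x)
        + (\<Sum>l\<le>Suc j. (if l \<le> j then u l * (p l - real j) else 0) * newton p l x)"
      unfolding sum.distrib by (subst sum.atMost_Suc_shift) (simp)
    also have "\<dots> = (\<Sum>l\<le>Suc j. w l * newton p l x) * real (Suc j)"
      unfolding sum.distrib[symmetric] sum_distrib_right
      by (intro sum.cong refl) (simp add: w_def field_simps)
    finally show ?thesis by simp
  qed
  moreover have "w (Suc j) = 1 / fact (Suc j)"
    by (simp add: w_def u)
  ultimately show ?case by blast
qed

text \<open>This is \<open>V\<close> for a sequence given as a function: for fixed \<open>j\<close>
  the denominators multiply to \<open>j!\<close>, and the numerators form a Newton polynomial
  evaluated at its next node.\<close>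

definition Vf :: "nat \<Rightarrow> (nat \<Rightarrow> real) \<Rightarrow> real" where
  "Vf n x = (\<Prod>j<n. newton x j (x j) / fact j)"

text \<open>Expanding every column in the Newton basis factors the matrix into a lower and an upper triangular one.\<close>

lemma det_newton_basis:
  fixes x :: "nat \<Rightarrow> real" and H :: "nat \<Rightarrow> nat \<Rightarrow> real"
  assumes u: "\<And>i j. i < n \<Longrightarrow> j < n \<Longrightarrow> A i j = (\<Sum>l\<le>j. u j l * H i l)"
    and H: "\<And>i l. i < l \<Longrightarrow> l < n \<Longrightarrow> H i l = 0"
  shows "det (mat n n (\<lambda>(i, j). A i j)) = (\<Prod>j<n. H j j * u j j)"
proof -
  let ?H = "mat n n (\<lambda>(i, j). H i j)" and ?U = "mat n n (\<lambda>(l, j). if l \<le> j then u j l else 0)"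
  have "mat n n (\<lambda>(i, j). A i j) = ?H * ?U"
  proof (rule eq_matI)
    fix i j assume "i < dim_row (?H * ?U)" "j < dim_col (?H * ?U)"
    then have ij: "i < n" "j < n" by auto
    have "A i j = (\<Sum>l\<in>{..j}. u j l * H i l)" using u ij by blast
    also have "\<dots> = (\<Sum>l\<in>{0..<n}. if l \<le> j then u j l * H i l else 0)"
      by (rule sum.mono_neutral_cong_left) (use ij in auto)
    finally show "mat n n (\<lambda>(i, j). A i j) $$ (i, j) = (?H * ?U) $$ (i, j)"
      using ij by (auto simp: scalar_prod_def intro!: sum.cong)
  qed auto
  also have "det \<dots> = det ?H * det ?U"
    by (rule det_mult) auto
  also have "det ?H = prod_list (diag_mat ?H)"
    by (rule det_lower_triangular[of n]) (auto simp: H)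
  also have "det ?U = prod_list (diag_mat ?U)"
    by (rule det_upper_triangular[of _ n]) (auto)
  finally show ?thesis
    by (simp add: prod_list_diag_prod prod.distrib atLeast0LessThan)
qed

text \<open>With the points themselves as nodes, the Newton matrix is lower triangular. Binomials
  instead of powers supply the factorials of \<open>V\<close> and stay binomials under
  summation.\<close>

lemma det_gbinomial:
  fixes x :: "nat \<Rightarrow> real"
  shows "det (mat n n (\<lambda>(i, j). x i gchoose j)) = Vf n x"
proof -
  obtain u where u: "\<And>j y. y gchoose j = (\<Sum>l\<le>j. u j l * newton x l y)" "\<And>j. u j j = 1 / fact j"
    using gbinomial_newton[of _ x] by metis
  have "det (mat n n (\<lambda>(i, j). x i gchoose j)) = (\<Prod>j<n. newton x j (x j) * u j j)"
    by (rule det_newton_basis[where H = "\<lambda>i l. newton x l (x i)"]) (auto simp: u(1) newton_eq_0)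
  then show ?thesis by (simp add: Vf_def u(2))
qed

text \<open>Row differences of the binomial matrix of size \<open>n + 1\<close>. In the Newton basis
  the constant terms cancel, and on the diagonal the subtracted value vanishes because
  \<open>x j\<close> is a node.\<close>

lemma det_gbinomial_diff:
  fixes x :: "nat \<Rightarrow> real"
  shows "det (mat n n (\<lambda>(i, j). (x (Suc i) gchoose Suc j) - (x i gchoose Suc j))) = Vf (Suc n) x"
proof -
  obtain u where u: "\<And>j y. y gchoose j = (\<Sum>l\<le>j. u j l * newton x l y)" "\<And>j. u j j = 1 / fact j"
    using gbinomial_newton[of _ x] by metis
  have eq: "(x (Suc i) gchoose Suc j) - (x i gchoose Suc j)
      = (\<Sum>l\<le>j. u (Suc j) (Suc l) * (newton x (Suc l) (x (Suc i)) - newton x (Suc l) (x i)))" for i j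
    unfolding u(1) sum.atMost_Suc_shift right_diff_distrib sum_subtractf
    by (simp add: newton_def)
  have "det (mat n n (\<lambda>(i, j). (x (Suc i) gchoose Suc j) - (x i gchoose Suc j)))
      = (\<Prod>j<n. (newton x (Suc j) (x (Suc j)) - newton x (Suc j) (x j)) * u (Suc j) (Suc j))"
    by (rule det_newton_basis[where
          H = "\<lambda>i l. newton x (Suc l) (x (Suc i)) - newton x (Suc l) (x i)"
          and u = "\<lambda>j l. u (Suc j) (Suc l)"])
      (auto simp: newton_eq_0 eq)
  also have "\<dots> = Vf (Suc n) x"
    unfolding Vf_def prod.lessThan_Suc_shift
    by (simp add: u(2) newton_eq_0) (simp add: newton_def)
  finally show ?thesis .
qed

text \<open>Multilinearity in the rows: row \<open>i\<close> depends on \<open>f i\<close> alone, so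
  in every Leibniz term the sum of products factors into a product of sums.\<close>

lemma sum_PiE_det:
  fixes g :: "nat \<Rightarrow> 'b \<Rightarrow> 'a::comm_ring_1"
  assumes "\<And>i. i < n \<Longrightarrow> finite (I i)"
  shows "(\<Sum>f\<in>Pi\<^sub>E {..<n} I. det (mat n n (\<lambda>(i, j). g j (f i))))
    = det (mat n n (\<lambda>(i, j). \<Sum>q\<in>I i. g j q))"
proof -
  have lt: "p i < n" if "p permutes {0..<n}" "i < n" for p i
    using that permutes_in_image[of p "{0..<n}" i] by auto
  have prod: "(\<Prod>i<n. \<Sum>q\<in>I i. g (p i) q) = (\<Sum>f\<in>Pi\<^sub>E {..<n} I. \<Prod>i<n. g (p i) (f i))"
    if "p permutes {0..<n}" for p
    by (rule prod_sum_PiE) (use assms in auto)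
  have leibniz: "det (mat n n (\<lambda>(i, j). h i j)) = (\<Sum>p | p permutes {0..<n}. signof p * (\<Prod>i<n. h i (p i)))"
    for h :: "nat \<Rightarrow> nat \<Rightarrow> 'a"
    by (subst det_def'[of _ n]) (auto intro!: sum.cong prod.cong simp: lt atLeast0LessThan)
  show ?thesis
    unfolding leibniz
    by (subst sum.swap) (simp add: prod sum_distrib_left)
qed

text \<open>Pascal's rule makes the sum telescope. Positions may be negative, hence generalized
  binomials.\<close>

lemma sum_gbinomial_interval:
  fixes a b :: int
  assumes "a \<le> b"
  shows "(\<Sum>q\<in>{a..<b}. real_of_int q gchoose j) = (of_int b gchoose Suc j) - (of_int a gchoose Suc j)"
  using assms
proof (induction b rule: int_ge_induct)
  case (step b)
  have "{a..<b + 1} = insert b {a..<b}" using step by auto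
  then show ?case using step by (simp add: gbinomial_Suc_Suc)
qed simp

text \<open>One layer of the Gelfand-Tsetlin recursion: summing row \<open>i\<close> of the binomial
  determinant over its own interval yields the difference matrix, whose determinant is the product
  of the next size.\<close>

lemma sum_Vf_interlacing:
  fixes x :: "nat \<Rightarrow> int"
  assumes "\<And>i. i < n \<Longrightarrow> x i \<le> x (Suc i)"
  shows "(\<Sum>f\<in>Pi\<^sub>E {..<n} (\<lambda>i. {x i..<x (Suc i)}). Vf n (\<lambda>i. of_int (f i))) = Vf (Suc n) (\<lambda>i. of_int (x i))"
proof -
  have "(\<Sum>f\<in>Pi\<^sub>E {..<n} (\<lambda>i. {x i..<x (Suc i)}). Vf n (\<lambda>i. of_int (f i)))
    = det (mat n n (\<lambda>(i, j). \<Sum>q\<in>{x i..<x (Suc i)}. real_of_int q gchoose j))"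
    by (subst sum_PiE_det[symmetric]) (auto simp: det_gbinomial)
  also have "\<dots> = Vf (Suc n) (\<lambda>i. of_int (x i))"
    by (subst det_gbinomial_diff[symmetric]) (intro arg_cong[where f = det] eq_matI, auto simp: sum_gbinomial_interval assms)
  finally show ?thesis .
qed

lemma V_eq_Vf: "V xs = Vf (length xs) (\<lambda>i. of_int (xs ! i))"
proof -
  have "(\<Prod>i<j. real j - real i) = fact j" for j :: nat
    by (simp add: fact_prod_rev atLeast0LessThan of_nat_diff)
  then show ?thesis
    by (simp add: V_def Vf_def newton_def prod_dividef)
qed

section \<open>Interlacing sets and chains of steps\<close>

definition below :: "int set \<Rightarrow> int \<Rightarrow> int" where
  "below X m = int (card {x \<in> X. x < m})"

lemma below_nonneg [simp]: "0 \<le> below X m"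
  by (simp add: below_def)

lemma below_Suc: "finite X \<Longrightarrow> below X (m + 1) = below X m + of_bool (m \<in> X)"
proof -
  assume X: "finite X"
  have "{x \<in> X. x < m + 1} = {x \<in> X. x < m} \<union> (if m \<in> X then {m} else {})"
    by (auto simp: less_le)
  then show ?thesis using X by (simp add: below_def card_insert_if)
qed

lemma below_le_card: "finite X \<Longrightarrow> below X m \<le> int (card X)"
  by (auto simp: below_def intro!: card_mono)

lemma below_eq_card_iff: "finite X \<Longrightarrow> below X m = int (card X) \<longleftrightarrow> X \<subseteq> {..<m}"
proof
  assume "finite X" "below X m = int (card X)"
  then have "{x \<in> X. x < m} = X" by (intro card_subset_eq) (auto simp: below_def)
  then show "X \<subseteq> {..<m}" by auto
next
  assume "X \<subseteq> {..<m}"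
  then have "{x \<in> X. x < m} = X" by auto
  then show "below X m = int (card X)" by (simp add: below_def)
qed

lemma below_eq_0_iff: "finite X \<Longrightarrow> below X m = 0 \<longleftrightarrow> X \<subseteq> {m..}"
  by (auto simp: below_def not_less)

lemma below_interval: "s \<le> t \<Longrightarrow> below {s..<t} m = max 0 (min m t - s)"
proof -
  assume "s \<le> t"
  have "{x \<in> {s..<t}. x < m} = {s..<min m t}" by auto
  then have "below {s..<t} m = int (card {s..<min m t})" by (simp only: below_def)
  then show ?thesis using \<open>s \<le> t\<close> by auto
qed

lemma below_Diff:
  assumes "finite Y" "X \<subseteq> Y"
  shows "below (Y - X) m = below Y m - below X m"
proof -
  have "{x \<in> Y. x < m} = {x \<in> Y - X. x < m} \<union> {x \<in> X. x < m}" using assms by auto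
  moreover have "finite X" using assms finite_subset by blast
  ultimately have "card {x \<in> Y. x < m} = card {x \<in> Y - X. x < m} + card {x \<in> X. x < m}"
    using assms by (simp only:) (rule card_Un_disjoint, auto)
  then show ?thesis by (simp add: below_def)
qed

lemma below_shift: "below ((+) t ` X) m = below X (m - t)"
proof -
  have "{x \<in> (+) t ` X. x < m} = (+) t ` {x \<in> X. x < m - t}" by auto
  then show ?thesis by (simp add: below_def card_image)
qed

text \<open>Indexing and counting are adjoint: in a strictly sorted list the index of an entry is
  the number of entries below it.\<close>

lemma nth_less_iff_below:
  assumes "sorted_wrt (<) xs" "i < length xs"
  shows "xs ! i < m \<longleftrightarrow> int i < below (set xs) m"
  using assms
proof (induction xs arbitrary: i)
  case (Cons a xs)
  have "{x \<in> set (a # xs). x < m} = {x \<in> set xs. x < m} \<union> (if a < m then {a} else {})" by auto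
  moreover have "a \<notin> set xs" using Cons.prems by auto
  ultimately have b: "below (set (a # xs)) m = below (set xs) m + of_bool (a < m)"
    by (simp add: below_def card_insert_if)
  have z: "below (set xs) m = 0" if "\<not> a < m"
    using that Cons.prems by (subst below_eq_0_iff) force+
  show ?case
  proof (cases i)
    case 0
    then show ?thesis using b z below_nonneg[of "set xs" m] by (auto simp: of_bool_def)
  next
    case (Suc j)
    then have j: "j < length xs" "a < xs ! j" using Cons.prems by auto
    then show ?thesis using b z Cons.IH[of j] Cons.prems Suc by (auto simp: of_bool_def)
  qed
qed simp

text \<open>Counting form of x_0 \<le> y_0 < x_1 \<le> y_1 < ... for the elements x of
  \<open>P\<close> and y of \<open>Q\<close>. The argument \<open>m + 1\<close> makes the bound y_i
  < x_(i+1) strict; cardinalities are imposed separately.\<close>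

definition interlaces :: "int set \<Rightarrow> int set \<Rightarrow> bool" where
  "interlaces Q P \<longleftrightarrow> (\<forall>m. below Q m \<le> below P m \<and> below P (m + 1) \<le> below Q m + 1)"

lemma interlaces_iff_nth:
  assumes xs: "sorted_wrt (<) xs" "length xs = Suc n" and ys: "sorted_wrt (<) ys" "length ys = n"
  shows "interlaces (set ys) (set xs) \<longleftrightarrow> (\<forall>i<n. xs ! i \<le> ys ! i \<and> ys ! i < xs ! Suc i)"
proof
  assume il: "interlaces (set ys) (set xs)"
  show "\<forall>i<n. xs ! i \<le> ys ! i \<and> ys ! i < xs ! Suc i"
  proof (intro allI impI conjI)
    fix i assume i: "i < n"
    have "int i < below (set ys) (ys ! i + 1)"
      using nth_less_iff_below[of ys i "ys ! i + 1"] ys i by simp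
    also have "\<dots> \<le> below (set xs) (ys ! i + 1)" using il by (simp add: interlaces_def)
    finally show "xs ! i \<le> ys ! i"
      using nth_less_iff_below[of xs i "ys ! i + 1"] xs i by simp
    have "int (Suc i) < below (set xs) (xs ! Suc i + 1)"
      using nth_less_iff_below[of xs "Suc i" "xs ! Suc i + 1"] xs i by simp
    also have "\<dots> \<le> below (set ys) (xs ! Suc i) + 1" using il by (simp add: interlaces_def)
    finally show "ys ! i < xs ! Suc i"
      using nth_less_iff_below[of ys i "xs ! Suc i"] ys i by simp
  qed
next
  assume *: "\<forall>i<n. xs ! i \<le> ys ! i \<and> ys ! i < xs ! Suc i"
  have le: "below (set ys) m \<le> int n" "below (set xs) m \<le> int (Suc n)" for m
    using below_le_card[of "set ys" m] card_length[of ys] ys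
      below_le_card[of "set xs" m] card_length[of xs] xs by auto
  show "interlaces (set ys) (set xs)"
    unfolding interlaces_def
  proof (intro allI conjI)
    fix m
    show "below (set ys) m \<le> below (set xs) m"
    proof (rule ccontr)
      assume c: "\<not> ?thesis"
      \<comment> \<open>The smaller count is the index at which the entrywise inequality fails:
        \<open>xs ! i\<close> is not below \<open>m\<close>, whereas \<open>ys ! i\<close>
        is.\<close>
      define i where "i = nat (below (set xs) m)"
      have i: "int i = below (set xs) m" by (simp add: i_def)
      with c le(1)[of m] have "i < n" "int i < below (set ys) m" by auto
      then have "ys ! i < m" using nth_less_iff_below[of ys i m] ys by simp
      with * \<open>i < n\<close> have "xs ! i < m" by force
      then show False using nth_less_iff_below[of xs i m] xs \<open>i < n\<close> i by simp
    qed
    show "below (set xs) (m + 1) \<le> below (set ys) m + 1"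
    proof (rule ccontr)
      assume c: "\<not> ?thesis"
      define i where "i = nat (below (set ys) m)"
      have i: "int i = below (set ys) m" by (simp add: i_def)
      with c le(2)[of "m + 1"] have "i < n" "int (Suc i) < below (set xs) (m + 1)" by auto
      then have "xs ! Suc i < m + 1" using nth_less_iff_below[of xs "Suc i" "m + 1"] xs by simp
      with * \<open>i < n\<close> have "ys ! i < m" by force
      then show False using nth_less_iff_below[of ys i m] ys \<open>i < n\<close> i by simp
    qed
  qed
qed

section \<open>Summation over interlacing sets\<close>

definition Vset :: "int set \<Rightarrow> real" where
  "Vset X = V (sorted_list_of_set X)"

lemma V_eq_Vset: "sorted_wrt (<) xs \<Longrightarrow> V xs = Vset (set xs)"
  by (simp add: Vset_def sorted_list_of_set.idem_if_sorted_distinct strict_sorted_iff)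

lemma V_map_add: "V (map ((+) t) xs) = V xs"
  by (simp add: V_def)

lemma Vset_shift:
  assumes "finite X"
  shows "Vset ((+) t ` X) = Vset X"
proof -
  let ?xs = "sorted_list_of_set X"
  have "sorted_wrt (<) (map ((+) t) ?xs)"
    using strict_sorted_list_of_set[of X] by (simp add: sorted_wrt_map)
  from V_eq_Vset[OF this] show ?thesis
    using assms by (simp add: V_map_add Vset_def)
qed

text \<open>One point chosen in each of the \<open>n\<close> consecutive half-open intervals comes
  out strictly sorted, so such choices correspond to interlacing sets by taking images.\<close>

lemma sum_Vset_interlacing:
  assumes P: "finite P" "card P = Suc n"
  shows "(\<Sum>Q | finite Q \<and> card Q = n \<and> interlaces Q P. Vset Q) = Vset P"
proof -
  define xs where "xs = sorted_list_of_set P"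
  have xs: "sorted_wrt (<) xs" "length xs = Suc n" "set xs = P"
    using P by (simp_all add: xs_def)
  have xs_le: "xs ! i \<le> xs ! Suc i" if "i < n" for i
    using xs that by (auto simp: sorted_wrt_nth_less less_imp_le)
  let ?F = "Pi\<^sub>E {..<n} (\<lambda>i. {xs ! i..<xs ! Suc i})"
  have sorted: "sorted_wrt (<) (map f [0..<n])" if "f \<in> ?F" for f
    unfolding sorted_wrt_iff_nth_Suc_transp[OF transp_on_less]
  proof (intro allI impI)
    fix i assume "Suc i < length (map f [0..<n])"
    then show "map f [0..<n] ! i < map f [0..<n] ! Suc i"
      using PiE_mem[OF that, of i] PiE_mem[OF that, of "Suc i"] by auto
  qed
  have img: "set (map f [0..<n]) = f ` {..<n}" for f :: "nat \<Rightarrow> int"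
    by (auto simp: lessThan_atLeast0)
  have VF: "Vset (f ` {..<n}) = Vf n (\<lambda>i. of_int (f i))" if "f \<in> ?F" for f
    unfolding img[symmetric] V_eq_Vset[OF sorted[OF that], symmetric] V_eq_Vf
    by (simp add: Vf_def newton_def)
  have list: "sorted_list_of_set (f ` {..<n}) = map f [0..<n]" if "f \<in> ?F" for f
    using sorted[OF that] img[of f]
    by (metis sorted_list_of_set.idem_if_sorted_distinct strict_sorted_iff)
  have "bij_betw (\<lambda>f. f ` {..<n}) ?F {Q. finite Q \<and> card Q = n \<and> interlaces Q P}"
  proof (rule bij_betw_byWitness[where f' = "\<lambda>Q. restrict ((!) (sorted_list_of_set Q)) {..<n}"])
    show "\<forall>f\<in>?F. restrict ((!) (sorted_list_of_set (f ` {..<n}))) {..<n} = f"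
      by (auto simp: list fun_eq_iff restrict_def PiE_def extensional_def)
    show "\<forall>Q\<in>{Q. finite Q \<and> card Q = n \<and> interlaces Q P}.
        restrict ((!) (sorted_list_of_set Q)) {..<n} ` {..<n} = Q"
    proof safe
      fix Q :: "int set" and x assume "finite Q" "x \<in> Q" "n = card Q"
      then show "x \<in> restrict ((!) (sorted_list_of_set Q)) {..<card Q} ` {..<card Q}"
        using in_set_conv_nth[of x "sorted_list_of_set Q"] by auto
    next
      fix Q :: "int set" and i assume "finite Q" "i < card Q"
      then show "restrict ((!) (sorted_list_of_set Q)) {..<card Q} i \<in> Q"
        using nth_mem[of i "sorted_list_of_set Q"] by simp
    qed
    show "(\<lambda>f. f ` {..<n}) ` ?F \<subseteq> {Q. finite Q \<and> card Q = n \<and> interlaces Q P}"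
    proof (intro image_subsetI CollectI conjI)
      fix f assume f: "f \<in> ?F"
      show "card (f ` {..<n}) = n"
        using distinct_card[of "map f [0..<n]"] sorted[OF f] img[of f] by (simp add: strict_sorted_iff)
      show "interlaces (f ` {..<n}) P"
        unfolding img[symmetric] xs(3)[symmetric]
        using interlaces_iff_nth[OF xs(1,2) sorted[OF f]] PiE_mem[OF f] by auto
    qed simp
    show "(\<lambda>Q. restrict ((!) (sorted_list_of_set Q)) {..<n}) `
        {Q. finite Q \<and> card Q = n \<and> interlaces Q P} \<subseteq> ?F"
    proof (intro image_subsetI)
      fix Q assume "Q \<in> {Q. finite Q \<and> card Q = n \<and> interlaces Q P}"
      then have Q: "finite Q" "card Q = n" "interlaces Q P" by auto
      then show "restrict ((!) (sorted_list_of_set Q)) {..<n} \<in> ?F"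
        using interlaces_iff_nth[OF xs(1,2), of "sorted_list_of_set Q"] xs(3) by auto
    qed
  qed
  then have "(\<Sum>Q | finite Q \<and> card Q = n \<and> interlaces Q P. Vset Q) = (\<Sum>f\<in>?F. Vset (f ` {..<n}))"
    by (rule sum.reindex_bij_betw[symmetric])
  also have "\<dots> = (\<Sum>f\<in>?F. Vf n (\<lambda>i. of_int (f i)))"
    by (rule sum.cong) (simp_all add: VF)
  also have "\<dots> = Vf (Suc n) (\<lambda>i. of_int (xs ! i))"
    by (rule sum_Vf_interlacing) (rule xs_le)
  also have "\<dots> = Vset P"
    by (simp add: Vset_def V_eq_Vf xs(2) flip: xs_def)
  finally show ?thesis .
qed

text \<open>Counting form of: the \<open>i\<close>-th smallest element of \<open>D\<close> is that of \<open>C\<close> or its successor, for all \<open>i\<close>.\<close>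

definition step :: "int set \<Rightarrow> int set \<Rightarrow> bool" where
  "step C D \<longleftrightarrow> (\<forall>m. below D m \<le> below C m \<and> below C m \<le> below D (m + 1))"

text \<open>Beyond all elements the counts are the cardinalities, and the two step inequalities
  meet.\<close>

lemma step_card:
  assumes "step C D" "finite C" "finite D"
  shows "card D = card C"
proof -
  obtain t where t: "C \<union> D \<subseteq> {..<t}"
    using assms finite_has_maximal[of "insert 0 (C \<union> D)"] 
    by (metis Max_less_iff empty_iff finite_Un lessThan_iff less_add_one linorder_neqE subsetI Max_ge order.strict_trans1)
  then have "below C t = card C" "below D t = card D" "below D (t + 1) = card D"
    using assms by (auto simp: below_eq_card_iff)
  moreover have "below D t \<le> below C t" "below C t \<le> below D (t + 1)"
    using assms(1) by (auto simp: step_def)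
  ultimately show ?thesis by linarith
qed

lemma step_forward_subset:
  assumes "step C D" "finite C" "finite D" "C \<subseteq> {s..<t}"
  shows "D \<subseteq> {s..<t + 1}"
proof -
  have "C \<subseteq> {s..}" "C \<subseteq> {..<t}" using assms(4) by auto
  then have "below C s = 0" "below C t = card C"
    using assms by (simp_all add: below_eq_0_iff below_eq_card_iff)
  moreover have "below D s \<le> below C s" "below C t \<le> below D (t + 1)"
    using assms(1) by (auto simp: step_def)
  ultimately have "below D s = 0" "below D (t + 1) = card D"
    using below_nonneg[of D s] below_le_card[OF assms(3), of "t + 1"] step_card[OF assms(1-3)] by linarith+
  then have "D \<subseteq> {s..}" "D \<subseteq> {..<t + 1}"
    using assms(3) by (simp_all add: below_eq_0_iff below_eq_card_iff)
  then show ?thesis by (auto simp: subset_eq)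
qed

lemma step_shift: "step ((+) t ` C) ((+) t ` D) \<longleftrightarrow> step C D"
  unfolding step_def below_shift
  by (metis add_diff_cancel_left' add_diff_eq diff_add_eq)

text \<open>After translation by one, a step run backwards is again a step; hence the part of a chain below a
  given line can be counted like the part above it.\<close>

lemma step_reverse: "step D ((+) 1 ` C) \<longleftrightarrow> step C D"
  unfolding step_def below_shift
  by (metis add_diff_cancel_right' diff_add_cancel)

text \<open>Inside the window the complements have counts \<open>m - s\<close> minus those of
  \<open>C\<close> and \<open>D\<close>, so subtraction turns each step inequality into one
  interlacing inequality. Left of the window all counts vanish; right of it the equal cardinalities
  settle the claim.\<close>

lemma step_iff_interlaces:
  assumes C: "C \<subseteq> {s..<t}" and D: "D \<subseteq> {s..<t + 1}" and card: "card C = card D" and "s \<le> t"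
  shows "step C D \<longleftrightarrow> interlaces ({s..<t} - C) ({s..<t + 1} - D)"
proof -
  have fin: "finite C" "finite D" using C D finite_subset by blast+
  have b: "below ({s..<t} - C) m = max 0 (min m t - s) - below C m"
    "below ({s..<t + 1} - D) m = max 0 (min m (t + 1) - s) - below D m" for m
    using below_Diff[OF _ C] below_Diff[OF _ D] \<open>s \<le> t\<close> by (simp_all add: below_interval)
  have low: "below C m = 0" "below D m = 0" if "m \<le> s" for m
    using that C D fin by (auto simp: below_eq_0_iff)
  have highC: "below C m = card C" if "m \<ge> t" for m
    using that C fin by (subst below_eq_card_iff) auto
  have highD: "below D m = card C" if "m \<ge> t + 1" for m
    using that D fin unfolding card by (subst below_eq_card_iff) auto
  have "below D m \<le> below C m \<and> below C m \<le> below D (m + 1) \<longleftrightarrow>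
    below ({s..<t} - C) m \<le> below ({s..<t + 1} - D) m \<and>
    below ({s..<t + 1} - D) (m + 1) \<le> below ({s..<t} - C) m + 1" for m
  proof -
    consider "m < s" | "s \<le> m" "m \<le> t" | "t < m" by linarith
    then show ?thesis
    proof cases
      case 1
      then have "below D (m + 1) = 0" "below C m = 0" "below D m = 0" using low by auto
      then show ?thesis unfolding b using 1 \<open>s \<le> t\<close> by auto
    next
      case 2
      then show ?thesis unfolding b using \<open>s \<le> t\<close> by auto
    next
      case 3
      then have "below D (m + 1) = card C" "below C m = card C" "below D m = card C"
        using highC highD by auto
      then show ?thesis unfolding b using 3 \<open>s \<le> t\<close> by auto
    qed
  qed
  then show ?thesis by (simp add: step_def interlaces_def)
qed

text \<open>Having one element fewer than \<open>P\<close> forces \<open>Q\<close> into the smaller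
  window, so every interlacing set is the complement of a set of path positions.\<close>

lemma interlaces_subset:
  assumes "interlaces Q P" "finite Q" "finite P" "card P = Suc (card Q)" "P \<subseteq> {s..<t + 1}"
  shows "Q \<subseteq> {s..<t}"
proof -
  have "P \<subseteq> {s..}" "P \<subseteq> {..<t + 1}" using assms(5) by auto
  then have "below P s = 0" "below P (t + 1) = card P"
    using assms(3) by (simp_all add: below_eq_0_iff below_eq_card_iff)
  moreover have "below Q s \<le> below P s" "below P (t + 1) \<le> below Q t + 1"
    using assms(1) by (auto simp: interlaces_def)
  ultimately have "below Q s = 0" "below Q t = card Q"
    using below_nonneg[of Q s] below_le_card[OF assms(2), of t] assms(4) by linarith+
  then have "Q \<subseteq> {s..}" "Q \<subseteq> {..<t}"
    using assms(2) by (simp_all add: below_eq_0_iff below_eq_card_iff)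
  then show ?thesis by (auto simp: subset_eq)
qed

text \<open>The occupied positions of nonintersecting paths, line by line. Fixing the empty set
  beyond \<open>n\<close> makes a chain determined by its first \<open>n + 1\<close> entries, so
  that counting functions counts path families.\<close>

definition chains :: "nat \<Rightarrow> int set \<Rightarrow> int set \<Rightarrow> (nat \<Rightarrow> int set) set" where
  "chains n X Y = {C. C 0 = X \<and> C n = Y \<and> (\<forall>j<n. step (C j) (C (Suc j))) \<and>
     (\<forall>j. finite (C j)) \<and> (\<forall>j>n. C j = {})}"

lemma chains_card_subset:
  assumes "C \<in> chains n X Y" "X \<subseteq> {s..<t}" "j \<le> n"
  shows "card (C j) = card X \<and> C j \<subseteq> {s..<t + int j}"
  using assms(3)
proof (induction j)
  case 0
  then show ?case using assms by (simp add: chains_def)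
next
  case (Suc j)
  then have st: "step (C j) (C (Suc j))" "finite (C j)" "finite (C (Suc j))"
    using assms(1) by (auto simp: chains_def)
  then show ?case
    using Suc step_card[OF st] step_forward_subset[OF st, of s "t + int j"] by (auto simp: algebra_simps)
qed

text \<open>Removing the last step leaves a sum over the possible predecessors of \<open>Y\<close>;
  in terms of gaps these are the sets interlacing the gaps of \<open>Y\<close>, so the summation
  formula closes the induction. Finiteness is carried along because an infinite set would have
  cardinality 0.\<close>

theorem card_chains:
  assumes "Y \<subseteq> {s..<s + int b + int n}" "card Y = b"
  shows "finite (chains n {s..<s + int b} Y) \<and>
    real (card (chains n {s..<s + int b} Y)) = Vset ({s..<s + int b + int n} - Y)"
  using assms
proof (induction n arbitrary: Y)
  case 0
  then have Y: "Y = {s..<s + int b}" by (intro card_subset_eq) auto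
  have "chains 0 Y Y = {\<lambda>j. if j = 0 then Y else {}}"
    using Y by (auto simp: chains_def fun_eq_iff)
  then show ?case by (simp add: Y Vset_def V_def)
next
  case (Suc n)
  define X where "X = {s..<s + int b}"
  define t where "t = s + int b + int n"
  define P where "P = {s..<t + 1} - Y"
  define ZZ where "ZZ = {Z. Z \<subseteq> {s..<t} \<and> card Z = b \<and> step Z Y}"
  have Y: "Y \<subseteq> {s..<t + 1}" "card Y = b" "finite Y"
    using Suc.prems finite_subset[of Y] by (auto simp: t_def algebra_simps)
  have P: "finite P" "card P = Suc n"
    using Y by (simp_all add: P_def card_Diff_subset) (simp add: t_def)
  have IH: "finite (chains n X Z)" "real (card (chains n X Z)) = Vset ({s..<t} - Z)" if "Z \<in> ZZ" for Z
    using Suc.IH[of Z] that by (auto simp: ZZ_def X_def t_def)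
  have "finite ZZ" by (rule finite_subset[of _ "Pow {s..<t}"]) (auto simp: ZZ_def)
  have inj: "inj_on (\<lambda>C. C(Suc n := Y)) (chains n X Z)" for Z
  proof (rule inj_onI)
    fix C D assume *: "C \<in> chains n X Z" "D \<in> chains n X Z" "C(Suc n := Y) = D(Suc n := Y)"
    then have "C (Suc n) = D (Suc n)" by (simp add: chains_def)
    with *(3) show "C = D" by (metis fun_upd_triv fun_upd_upd)
  qed
  have decomp: "chains (Suc n) X Y = (\<Union>Z\<in>ZZ. (\<lambda>C. C(Suc n := Y)) ` chains n X Z)"
  proof (intro equalityI subsetI)
    fix C assume C: "C \<in> chains (Suc n) X Y"
    have "C n \<in> ZZ"
      using chains_card_subset[OF C, of s "s + int b" n] C
      by (auto simp: ZZ_def X_def t_def chains_def)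
    moreover have "C(Suc n := {}) \<in> chains n X (C n)"
      using C by (auto simp: chains_def)
    moreover have "C = (C(Suc n := {}))(Suc n := Y)"
      using C by (auto simp: chains_def)
    ultimately show "C \<in> (\<Union>Z\<in>ZZ. (\<lambda>C. C(Suc n := Y)) ` chains n X Z)" by blast
  next
    fix C assume "C \<in> (\<Union>Z\<in>ZZ. (\<lambda>C. C(Suc n := Y)) ` chains n X Z)"
    then show "C \<in> chains (Suc n) X Y"
      using Y by (auto simp: chains_def ZZ_def less_Suc_eq)
  qed
  have disj: "(\<lambda>C. C(Suc n := Y)) ` chains n X Z \<inter> (\<lambda>C. C(Suc n := Y)) ` chains n X Z' = {}"
    if "Z \<noteq> Z'" for Z Z'
  proof -
    have "D n = W" if "D \<in> (\<lambda>C. C(Suc n := Y)) ` chains n X W" for D W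
      using that by (auto simp: chains_def)
    then show ?thesis using that by blast
  qed
  have fin: "finite (chains (Suc n) X Y)"
    unfolding decomp using \<open>finite ZZ\<close> IH(1) by blast
  have "real (card (chains (Suc n) X Y)) = (\<Sum>Z\<in>ZZ. Vset ({s..<t} - Z))"
    unfolding decomp using \<open>finite ZZ\<close> IH disj by (subst card_UN_disjoint) (auto simp: card_image[OF inj])
  \<comment> \<open>Complementation in the window \<open>{s..<t}\<close> is an involution between
    predecessors of \<open>Y\<close> and sets interlacing \<open>P\<close>.\<close>
  also have "\<dots> = (\<Sum>Q | finite Q \<and> card Q = n \<and> interlaces Q P. Vset Q)"
  proof (rule sum.reindex_bij_witness[where i = "\<lambda>Q. {s..<t} - Q" and j = "\<lambda>Z. {s..<t} - Z"])
    fix Z assume "Z \<in> ZZ"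
    then have Z: "Z \<subseteq> {s..<t}" "card Z = b" "step Z Y" "finite Z"
      using finite_subset[of Z] by (auto simp: ZZ_def)
    show "{s..<t} - ({s..<t} - Z) = Z" using Z by blast
    have "interlaces ({s..<t} - Z) P"
      using step_iff_interlaces[OF Z(1) Y(1)] Z Y by (simp add: P_def t_def)
    then show "{s..<t} - Z \<in> {Q. finite Q \<and> card Q = n \<and> interlaces Q P}"
      using Z by (simp add: card_Diff_subset) (simp add: t_def)
  next
    fix Q assume "Q \<in> {Q. finite Q \<and> card Q = n \<and> interlaces Q P}"
    then have Q: "finite Q" "card Q = n" "interlaces Q P" by auto
    have sub: "Q \<subseteq> {s..<t}" by (rule interlaces_subset[OF Q(3,1)]) (use P Q in \<open>auto simp: P_def\<close>)
    show Q': "{s..<t} - ({s..<t} - Q) = Q" using sub by blast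
    have c: "card ({s..<t} - Q) = b" using sub Q by (simp add: card_Diff_subset t_def)
    then have "step ({s..<t} - Q) Y"
      using step_iff_interlaces[of "{s..<t} - Q" s t Y] Y Q Q' by (auto simp: P_def t_def)
    then show "{s..<t} - Q \<in> ZZ" using c by (auto simp: ZZ_def)
  qed simp
  also have "\<dots> = Vset P" by (rule sum_Vset_interlacing[OF P])
  finally show ?case
    using fin by (simp add: X_def P_def t_def algebra_simps)
qed

text \<open>Each reversed step needs a translation by one, so the \<open>j\<close>-th set of the
  reversed chain is translated by \<open>j\<close>, and the old start \<open>X\<close> appears
  translated by \<open>n\<close>.\<close>

lemma card_chains_reverse:
  "card (chains n X Y) = card (chains n Y ((+) (int n) ` X))"
proof -
  define f :: "(nat \<Rightarrow> int set) \<Rightarrow> nat \<Rightarrow> int set"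
    where "f C j = (if j \<le> n then (+) (int j) ` C (n - j) else {})" for C j
  \<comment> \<open>The set at index \<open>n - j\<close> was translated by \<open>n - j\<close>;
    this is undone.\<close>
  define g :: "(nat \<Rightarrow> int set) \<Rightarrow> nat \<Rightarrow> int set"
    where "g D j = (if j \<le> n then (+) (int j - int n) ` D (n - j) else {})" for D j
  have "bij_betw f (chains n X Y) (chains n Y ((+) (int n) ` X))"
  proof (rule bij_betw_byWitness[where f' = g])
    show "\<forall>C\<in>chains n X Y. g (f C) = C"
      by (auto simp: chains_def f_def g_def fun_eq_iff image_image of_nat_diff)
    show "\<forall>D\<in>chains n Y ((+) (int n) ` X). f (g D) = D"
      by (auto simp: chains_def f_def g_def fun_eq_iff image_image of_nat_diff)
    show "f ` chains n X Y \<subseteq> chains n Y ((+) (int n) ` X)"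
    proof (rule image_subsetI)
      fix C assume C: "C \<in> chains n X Y"
      have "step (f C j) (f C (Suc j))" if "j < n" for j
      proof -
        have "n - j = Suc (n - Suc j)" using that by simp
        then have "step (C (n - Suc j)) (C (n - j))"
          using C that by (auto simp: chains_def f_def g_def)
        then have "step ((+) (int j) ` C (n - j)) ((+) (int j) ` (+) 1 ` C (n - Suc j))"
          by (simp only: step_shift step_reverse)
        then show ?thesis using that by (simp add: f_def image_image algebra_simps)
      qed
      then show "f C \<in> chains n Y ((+) (int n) ` X)"
        using C by (simp add: chains_def f_def g_def)
    qed
    show "g ` chains n Y ((+) (int n) ` X) \<subseteq> chains n X Y"
    proof (rule image_subsetI)
      fix D assume D: "D \<in> chains n Y ((+) (int n) ` X)"
      have "step (g D j) (g D (Suc j))" if "j < n" for j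
      proof -
        have "n - j = Suc (n - Suc j)" using that by simp
        then have "step (D (n - Suc j)) (D (n - j))"
          using D that by (auto simp: chains_def f_def g_def)
        moreover have "(+) 1 ` (+) (int j - int n) ` D (n - j) = (+) (int (Suc j) - int n) ` D (n - j)"
          by (simp add: image_image algebra_simps)
        moreover have "(\<lambda>x. (+) (int (Suc j) - int n) x) ` D (n - Suc j) = (+) (int (Suc j) - int n) ` D (n - Suc j)"
          by simp
        ultimately have "step ((+) (int (Suc j) - int n) ` D (n - Suc j)) ((+) 1 ` (+) (int j - int n) ` D (n - j))"
          by (simp only: step_shift)
        then have "step ((+) (int j - int n) ` D (n - j)) ((+) (int (Suc j) - int n) ` D (n - Suc j))"
          by (simp only: step_reverse)
        then show ?thesis using that by (simp add: g_def)
      qed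
      then show "g D \<in> chains n X Y"
        using D by (simp add: chains_def f_def g_def image_image)
    qed
  qed
  then show ?thesis by (rule bij_betw_same_card)
qed

text \<open>A step relates only consecutive sets, so the parts before and after index
  \<open>k\<close> vary independently.\<close>

lemma card_chains_through:
  assumes "k \<le> n"
  shows "card {C \<in> chains n X Z. C k = Y} = card (chains k X Y) * card (chains (n - k) Y Z)"
proof -
  let ?f = "\<lambda>C. (\<lambda>j. if j \<le> k then C j else {}, \<lambda>j. C (k + j))"
  let ?g = "\<lambda>(C, D) j. if j \<le> k then C j else D (j - k)"
  have "bij_betw ?f {C \<in> chains n X Z. C k = Y} (chains k X Y \<times> chains (n - k) Y Z)"
  proof (rule bij_betw_byWitness[where f' = ?g])
    show "\<forall>C\<in>{C \<in> chains n X Z. C k = Y}. ?g (?f C) = C"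
      by (auto simp: fun_eq_iff)
    show "\<forall>p\<in>chains k X Y \<times> chains (n - k) Y Z. ?f (?g p) = p"
      by (auto simp: fun_eq_iff chains_def)
    show "?f ` {C \<in> chains n X Z. C k = Y} \<subseteq> chains k X Y \<times> chains (n - k) Y Z"
      using assms by (auto simp: chains_def)
    show "?g ` (chains k X Y \<times> chains (n - k) Y Z) \<subseteq> {C \<in> chains n X Z. C k = Y}"
    proof (rule image_subsetI)
      fix p assume "p \<in> chains k X Y \<times> chains (n - k) Y Z"
      then obtain C D where p: "p = (C, D)" and CD: "C \<in> chains k X Y" "D \<in> chains (n - k) Y Z"
        by blast
      have "step (?g (C, D) j) (?g (C, D) (Suc j))" if "j < n" for j
      proof -
        consider "Suc j \<le> k" | "j = k" | "k < j" by linarith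
        then show ?thesis
        proof cases
          case 2
          \<comment> \<open>At the joint \<open>C k = Y = D 0\<close>, so the step is the first one
            of \<open>D\<close>.\<close>
          then show ?thesis using CD that by (auto simp: chains_def dest!: spec[of _ "0::nat"])
        next
          case 3
          then have "step (D (j - k)) (D (Suc (j - k)))" using CD that by (auto simp: chains_def)
          then show ?thesis using 3 by (simp add: Suc_diff_le)
        qed (use CD in \<open>auto simp: chains_def\<close>)
      qed
      then show "?g p \<in> {C \<in> chains n X Z. C k = Y}"
        using CD assms by (auto simp: chains_def p)
    qed
  qed
  then show ?thesis
    by (simp add: bij_betw_same_card card_cartesian_product)
qed

text \<open>The reversed lower part starts at \<open>{c..<c+b}\<close> and makes
  \<open>a + c - k\<close> steps. Translating its final window back by that number gives
  \<open>{k-a..<b+c}\<close>.\<close>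

theorem card_chains_hexagon:
  assumes Y: "Y \<subseteq> {0..<int b + int k}" "Y \<subseteq> {int k - int a..<int b + int c}" "card Y = b"
    and "k \<le> a + c"
  shows "real (card {C \<in> chains (a + c) {0..<int b} {int c..<int c + int b}. C k = Y}) =
    Vset ({0..<int b + int k} - Y) * Vset ({int k - int a..<int b + int c} - Y)"
proof -
  let ?n = "a + c - k"
  have fin: "finite Y" using Y(1) finite_subset by blast
  have n: "int ?n = int a + int c - int k" using \<open>k \<le> a + c\<close> by (simp add: of_nat_diff)
  have up: "real (card (chains k {0..<int b} Y)) = Vset ({0..<int b + int k} - Y)"
    using card_chains[of Y 0 b k] Y by simp
  have eq: "(+) (int ?n) ` {int k - int a..<int b + int c} = {int c..<int c + int b + int ?n}"
    unfolding image_add_atLeastLessThan n by (simp add: algebra_simps)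
  have sub: "(+) (int ?n) ` Y \<subseteq> {int c..<int c + int b + int ?n}"
    using image_mono[OF Y(2), of "(+) (int ?n)"] eq by simp
  have "real (card (chains ?n Y {int c..<int c + int b}))
      = real (card (chains ?n {int c..<int c + int b} ((+) (int ?n) ` Y)))"
    by (simp only: card_chains_reverse[symmetric])
  also have "\<dots> = Vset ({int c..<int c + int b + int ?n} - (+) (int ?n) ` Y)"
    using card_chains[OF sub] Y(3) by (simp add: card_image)
  also have "\<dots> = Vset ((+) (int ?n) ` ({int k - int a..<int b + int c} - Y))"
    by (simp only: eq[symmetric] image_set_diff[OF inj_on_add])
  also have "\<dots> = Vset ({int k - int a..<int b + int c} - Y)"
    by (rule Vset_shift) simp
  finally show ?thesis
    by (simp add: card_chains_through[OF \<open>k \<le> a + c\<close>] up)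
qed

section \<open>Lozenges in lattice coordinates\<close>

text \<open>Coordinates in which lattice points are integral: \<open>dc\<close> is the depth below the top side of the
  hexagon, counted in lattice lines, \<open>xc\<close> is constant along its upper left side and \<open>sc\<close> along its
  upper right side.\<close>

definition xc :: "complex \<Rightarrow> real" where "xc z = Re z - Im z / sqrt 3"
definition dc :: "complex \<Rightarrow> real" where "dc z = - 2 * Im z / sqrt 3"
definition sc :: "complex \<Rightarrow> real" where "sc z = xc z - dc z"
definition pt :: "real \<Rightarrow> real \<Rightarrow> complex" where "pt x d = Complex (x - d / 2) (- (sqrt 3 / 2) * d)"

lemma coord_pt [simp]: "xc (pt x d) = x" "dc (pt x d) = d"
  by (simp_all add: xc_def dc_def pt_def)

lemma pt_coord [simp]: "pt (xc z) (dc z) = z"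
  by (simp add: xc_def dc_def pt_def complex_eq_iff)

lemma coord_eqI: "xc z = xc w \<Longrightarrow> dc z = dc w \<Longrightarrow> z = w"
  by (metis pt_coord)

lemma coord_simps [simp]:
  "xc 0 = 0" "dc 0 = 0" "xc 1 = 1" "dc 1 = 0"
  "xc (z + w) = xc z + xc w" "dc (z + w) = dc z + dc w"
  "xc (z - w) = xc z - xc w" "dc (z - w) = dc z - dc w"
  "xc (- z) = - xc z" "dc (- z) = - dc z"
  "xc (of_real r) = r" "dc (of_real r) = 0"
  "xc (of_int i) = of_int i" "dc (of_int i) = 0"
  "xc (of_nat n) = of_nat n" "dc (of_nat n) = 0"
  "xc (of_int i * z) = of_int i * xc z" "dc (of_int i * z) = of_int i * dc z"
  "xc (of_nat n * z) = of_nat n * xc z" "dc (of_nat n * z) = of_nat n * dc z"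
  "xc (r *\<^sub>R z) = r * xc z" "dc (r *\<^sub>R z) = r * dc z"
  by (simp_all add: xc_def dc_def field_simps)

lemma cis_60: "cis (pi / 3) = pt 0 (-1)"
  by (simp add: complex_eq_iff pt_def cos_60 sin_60)

lemma coord_cis_60_mult [simp]:
  "xc (cis (pi / 3) * z) = dc z" "dc (cis (pi / 3) * z) = dc z - xc z"
  unfolding cis_60 by (simp_all add: xc_def dc_def pt_def field_simps)

lemma coord_cis [simp]:
  "xc (cis (pi / 3)) = 0" "dc (cis (pi / 3)) = -1"
  "xc (cis (- (pi / 3))) = 1" "dc (cis (- (pi / 3))) = 1"
  "xc (cis (2 * pi / 3)) = -1" "dc (cis (2 * pi / 3)) = -1"
  "xc (cis (- (2 * pi / 3))) = 0" "dc (cis (- (2 * pi / 3))) = 1"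
proof -
  have c: "cos (2 * pi / 3) = - (1 / 2)" "sin (2 * pi / 3) = sqrt 3 / 2"
    using cos_120 sin_120 by auto
  show "xc (cis (pi / 3)) = 0" "dc (cis (pi / 3)) = -1"
    by (simp_all add: cis_60)
  show "xc (cis (- (pi / 3))) = 1" "dc (cis (- (pi / 3))) = 1"
    by (simp_all add: xc_def dc_def cos_60 sin_60)
  show "xc (cis (2 * pi / 3)) = -1" "dc (cis (2 * pi / 3)) = -1"
    by (simp_all add: xc_def dc_def c)
  show "xc (cis (- (2 * pi / 3))) = 0" "dc (cis (- (2 * pi / 3))) = 1"
    by (simp_all add: xc_def dc_def c)
qed

lemma tri_lattice_iff: "z \<in> tri_lattice \<longleftrightarrow> xc z \<in> \<int> \<and> dc z \<in> \<int>"
proof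
  assume "z \<in> tri_lattice"
  then show "xc z \<in> \<int> \<and> dc z \<in> \<int>" by (auto simp: tri_lattice_def)
next
  assume "xc z \<in> \<int> \<and> dc z \<in> \<int>"
  then obtain m n where mn: "xc z = of_int m" "dc z = of_int n" by (auto elim!: Ints_cases)
  then have "z = of_int m + of_int (- n) * cis (pi / 3)" by (intro coord_eqI) simp_all
  then show "z \<in> tri_lattice" unfolding tri_lattice_def by blast
qed

lemma norm_coord: "(norm z)\<^sup>2 = (xc z)\<^sup>2 - xc z * dc z + (dc z)\<^sup>2"
  unfolding cmod_power2 by (simp add: xc_def dc_def power2_eq_square field_simps)

lemma mem_convex_hull_parallelogram:
  "z \<in> convex hull {p, p + u, p + u + v, p + v} \<longleftrightarrow>
     (\<exists>\<alpha> \<beta>. 0 \<le> \<alpha> \<and> \<alpha> \<le> 1 \<and> 0 \<le> \<beta> \<and> \<beta> \<le> 1 \<and> z = p + \<alpha> *\<^sub>R u + \<beta> *\<^sub>R v)"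
  (is "_ \<longleftrightarrow> ?R z") for p u v :: complex
proof
  let ?S = "{z. ?R z}"
  have "convex ?S"
  proof (rule convexI, clarify)
    fix s t \<alpha> \<beta> \<gamma> \<delta> :: real
    assume st: "0 \<le> s" "0 \<le> t" "s + t = 1"
      and "0 \<le> \<alpha>" "\<alpha> \<le> 1" "0 \<le> \<beta>" "\<beta> \<le> 1" "0 \<le> \<gamma>" "\<gamma> \<le> 1" "0 \<le> \<delta>" "\<delta> \<le> 1"
    moreover have "s *\<^sub>R (p + \<alpha> *\<^sub>R u + \<beta> *\<^sub>R v) + t *\<^sub>R (p + \<gamma> *\<^sub>R u + \<delta> *\<^sub>R v)
      = (s + t) *\<^sub>R p + (s * \<alpha> + t * \<gamma>) *\<^sub>R u + (s * \<beta> + t * \<delta>) *\<^sub>R v"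
      by (simp add: algebra_simps)
    ultimately show "?R (s *\<^sub>R (p + \<alpha> *\<^sub>R u + \<beta> *\<^sub>R v) + t *\<^sub>R (p + \<gamma> *\<^sub>R u + \<delta> *\<^sub>R v))"
      by (intro exI[of _ "s * \<alpha> + t * \<gamma>"] exI[of _ "s * \<beta> + t * \<delta>"])
         (simp add: convex_bound_le)
  qed
  moreover have "{p, p + u, p + u + v, p + v} \<subseteq> ?S"
  proof -
    have "?R p" by (rule exI[of _ 0], rule exI[of _ 0]) simp
    moreover have "?R (p + u)" by (rule exI[of _ 1], rule exI[of _ 0]) simp
    moreover have "?R (p + u + v)" by (rule exI[of _ 1], rule exI[of _ 1]) simp
    moreover have "?R (p + v)" by (rule exI[of _ 0], rule exI[of _ 1]) simp
    ultimately show ?thesis by blast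
  qed
  ultimately have "convex hull {p, p + u, p + u + v, p + v} \<subseteq> ?S" by (intro hull_minimal)
  then show "z \<in> convex hull {p, p + u, p + u + v, p + v} \<Longrightarrow> ?R z" by blast
next
  let ?H = "convex hull {p, p + u, p + u + v, p + v}"
  assume "?R z"
  then obtain \<alpha> \<beta> where ab: "0 \<le> \<alpha>" "\<alpha> \<le> 1" "0 \<le> \<beta>" "\<beta> \<le> 1"
    and z: "z = p + \<alpha> *\<^sub>R u + \<beta> *\<^sub>R v" by blast
  have cv: "s *\<^sub>R a + t *\<^sub>R b \<in> ?H" if "a \<in> ?H" "b \<in> ?H" "0 \<le> s" "0 \<le> t" "s + t = 1" for a b s t
    using convexD[OF convex_convex_hull that] .
  have in_H: "p \<in> ?H" "p + u \<in> ?H" "p + u + v \<in> ?H" "p + v \<in> ?H" by (auto intro!: hull_inc)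
  \<comment> \<open>Bilinear interpolation: points with parameter \<alpha> on two opposite sides,
    joined with parameter \<beta>.\<close>
  have "(1 - \<beta>) *\<^sub>R ((1 - \<alpha>) *\<^sub>R p + \<alpha> *\<^sub>R (p + u)) + \<beta> *\<^sub>R ((1 - \<alpha>) *\<^sub>R (p + v) + \<alpha> *\<^sub>R (p + u + v)) \<in> ?H"
    using ab in_H by (intro cv) auto
  also have "(1 - \<beta>) *\<^sub>R ((1 - \<alpha>) *\<^sub>R p + \<alpha> *\<^sub>R (p + u)) + \<beta> *\<^sub>R ((1 - \<alpha>) *\<^sub>R (p + v) + \<alpha> *\<^sub>R (p + u + v)) = z"
    by (simp add: z algebra_simps)
  finally show "z \<in> ?H" .
qed

lemma mem_convex_hull_rhombus:
  "z \<in> convex hull (rhombus_corners p u) \<longleftrightarrow>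
     (\<exists>\<alpha> \<beta>. 0 \<le> \<alpha> \<and> \<alpha> \<le> 1 \<and> 0 \<le> \<beta> \<and> \<beta> \<le> 1 \<and>
       xc z = xc p + \<alpha> * xc u + \<beta> * dc u \<and> dc z = dc p + \<alpha> * dc u + \<beta> * (dc u - xc u))"
proof -
  have "z = p + \<alpha> *\<^sub>R u + \<beta> *\<^sub>R (cis (pi / 3) * u) \<longleftrightarrow>
    xc z = xc p + \<alpha> * xc u + \<beta> * dc u \<and> dc z = dc p + \<alpha> * dc u + \<beta> * (dc u - xc u)" for \<alpha> \<beta>
    by (auto intro!: coord_eqI)
  then show ?thesis
    unfolding rhombus_corners_def mem_convex_hull_parallelogram by simp
qed

text \<open>\<open>Lft\<close> and \<open>Rgt\<close> carry a path to the next line, half a unit to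
  the left or right; in the skew coordinate \<open>xc\<close> these moves are \<open>m\<close> to
  \<open>m\<close> and \<open>m\<close> to \<open>m + 1\<close>. \<open>Ver\<close> marks a
  gap.\<close>

datatype shape = Lft | Rgt | Ver

text \<open>All three \<open>loz t m q\<close> contain the downward unit triangle whose horizontal side joins the points
  with coordinates \<open>(m, q)\<close> and \<open>(m + 1, q)\<close>.\<close>

definition loz :: "shape \<Rightarrow> int \<Rightarrow> int \<Rightarrow> complex set" where
  "loz t m q = {z. (t \<noteq> Rgt \<longrightarrow> of_int m \<le> xc z \<and> xc z \<le> of_int m + 1) \<and>
     (t \<noteq> Ver \<longrightarrow> of_int q \<le> dc z \<and> dc z \<le> of_int q + 1) \<and>
     (t \<noteq> Lft \<longrightarrow> of_int (m - q) \<le> sc z \<and> sc z \<le> of_int (m - q) + 1)}"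

text \<open>Each of \<open>xc\<close>, \<open>dc\<close>, \<open>sc\<close> is constant along one
  lattice direction, so a rhombus is the intersection of two unit strips, and \<alpha>, \<beta> are
  read off from two coordinates.\<close>

lemma rhombus_Lft_1:
  assumes "xc u = 1" "dc u = 0"
  shows "z \<in> convex hull (rhombus_corners p u) \<longleftrightarrow> xc p \<le> xc z \<and> xc z \<le> xc p + 1 \<and> dc p - 1 \<le> dc z \<and> dc z \<le> dc p" (is "_ = ?R")
proof
  show "z \<in> convex hull (rhombus_corners p u) \<Longrightarrow> ?R"
    using assms by (auto simp: mem_convex_hull_rhombus sc_def)
  show "?R \<Longrightarrow> z \<in> convex hull (rhombus_corners p u)"
    unfolding mem_convex_hull_rhombus using assms
    by - (rule exI[of _ "xc z - xc p"], rule exI[of _ "dc p - dc z"], auto simp: sc_def)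
qed

lemma rhombus_Lft_2:
  assumes "xc u = -1" "dc u = 0"
  shows "z \<in> convex hull (rhombus_corners p u) \<longleftrightarrow> xc p - 1 \<le> xc z \<and> xc z \<le> xc p \<and> dc p \<le> dc z \<and> dc z \<le> dc p + 1" (is "_ = ?R")
proof
  show "z \<in> convex hull (rhombus_corners p u) \<Longrightarrow> ?R"
    using assms by (auto simp: mem_convex_hull_rhombus sc_def)
  show "?R \<Longrightarrow> z \<in> convex hull (rhombus_corners p u)"
    unfolding mem_convex_hull_rhombus using assms
    by - (rule exI[of _ "xc p - xc z"], rule exI[of _ "dc z - dc p"], auto simp: sc_def)
qed

lemma rhombus_Ver_1:
  assumes "xc u = 0" "dc u = -1"
  shows "z \<in> convex hull (rhombus_corners p u) \<longleftrightarrow> xc p - 1 \<le> xc z \<and> xc z \<le> xc p \<and> sc p \<le> sc z \<and> sc z \<le> sc p + 1" (is "_ = ?R")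
proof
  show "z \<in> convex hull (rhombus_corners p u) \<Longrightarrow> ?R"
    using assms by (auto simp: mem_convex_hull_rhombus sc_def)
  show "?R \<Longrightarrow> z \<in> convex hull (rhombus_corners p u)"
    unfolding mem_convex_hull_rhombus using assms
    by - (rule exI[of _ "sc z - sc p"], rule exI[of _ "xc p - xc z"], auto simp: sc_def)
qed

lemma rhombus_Ver_2:
  assumes "xc u = 0" "dc u = 1"
  shows "z \<in> convex hull (rhombus_corners p u) \<longleftrightarrow> xc p \<le> xc z \<and> xc z \<le> xc p + 1 \<and> sc p - 1 \<le> sc z \<and> sc z \<le> sc p" (is "_ = ?R")
proof
  show "z \<in> convex hull (rhombus_corners p u) \<Longrightarrow> ?R"
    using assms by (auto simp: mem_convex_hull_rhombus sc_def)
  show "?R \<Longrightarrow> z \<in> convex hull (rhombus_corners p u)"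
    unfolding mem_convex_hull_rhombus using assms
    by - (rule exI[of _ "sc p - sc z"], rule exI[of _ "xc z - xc p"], auto simp: sc_def)
qed

lemma rhombus_Rgt_1:
  assumes "xc u = -1" "dc u = -1"
  shows "z \<in> convex hull (rhombus_corners p u) \<longleftrightarrow> dc p - 1 \<le> dc z \<and> dc z \<le> dc p \<and> sc p - 1 \<le> sc z \<and> sc z \<le> sc p" (is "_ = ?R")
proof
  show "z \<in> convex hull (rhombus_corners p u) \<Longrightarrow> ?R"
    using assms by (auto simp: mem_convex_hull_rhombus sc_def)
  show "?R \<Longrightarrow> z \<in> convex hull (rhombus_corners p u)"
    unfolding mem_convex_hull_rhombus using assms
    by - (rule exI[of _ "dc p - dc z"], rule exI[of _ "sc p - sc z"], auto simp: sc_def)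
qed

lemma rhombus_Rgt_2:
  assumes "xc u = 1" "dc u = 1"
  shows "z \<in> convex hull (rhombus_corners p u) \<longleftrightarrow> dc p \<le> dc z \<and> dc z \<le> dc p + 1 \<and> sc p \<le> sc z \<and> sc z \<le> sc p + 1" (is "_ = ?R")
proof
  show "z \<in> convex hull (rhombus_corners p u) \<Longrightarrow> ?R"
    using assms by (auto simp: mem_convex_hull_rhombus sc_def)
  show "?R \<Longrightarrow> z \<in> convex hull (rhombus_corners p u)"
    unfolding mem_convex_hull_rhombus using assms
    by - (rule exI[of _ "dc z - dc p"], rule exI[of _ "sc z - sc p"], auto simp: sc_def)
qed

lemmas rhombus_Lft = rhombus_Lft_1 rhombus_Lft_2
lemmas rhombus_Ver = rhombus_Ver_1 rhombus_Ver_2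
lemmas rhombus_Rgt = rhombus_Rgt_1 rhombus_Rgt_2

text \<open>The six units of the Eisenstein lattice; completing the square bounds both coordinates
  by 1.\<close>

lemma int_norm_one:
  fixes m n :: int
  assumes "m\<^sup>2 - m * n + n\<^sup>2 = 1"
  shows "(m, n) \<in> {(1, 0), (-1, 0), (0, 1), (0, -1), (1, 1), (-1, -1)}"
proof -
  have "(2 * m - n)\<^sup>2 + 3 * n\<^sup>2 = 4" "(2 * n - m)\<^sup>2 + 3 * m\<^sup>2 = 4"
    using assms by (simp_all add: power2_eq_square algebra_simps)
  then have "n\<^sup>2 < 4" "m\<^sup>2 < 4"
    using zero_le_power2[of "2 * m - n"] zero_le_power2[of "2 * n - m"] by linarith+
  then have "\<bar>n\<bar> < 2" "\<bar>m\<bar> < 2"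
    using power2_less_imp_less[of "\<bar>n\<bar>" 2] power2_less_imp_less[of "\<bar>m\<bar>" 2] by simp_all
  then have "n \<in> {-1, 0, 1}" "m \<in> {-1, 0, 1}" by auto
  then show ?thesis using assms by auto
qed

text \<open>A lattice side of length one is one of six units, and opposite units give the same shape
  because a rhombus can be listed from either acute corner.\<close>

lemma lozenges_eq: "lozenges = {loz t m q | t m q. True}"
proof (intro equalityI subsetI)
  fix L assume "L \<in> lozenges"
  then obtain p u where L: "L = convex hull (rhombus_corners p u)" and "norm u = 1"
    and "p \<in> tri_lattice" "p + u \<in> tri_lattice"
    by (auto simp: lozenges_def rhombus_corners_def)
  then have "xc p \<in> \<int>" "dc p \<in> \<int>" "xc (p + u) - xc p \<in> \<int>" "dc (p + u) - dc p \<in> \<int>"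
    unfolding tri_lattice_iff by (blast intro: Ints_diff)+
  then obtain i j m n where ij: "xc p = of_int i" "dc p = of_int j"
    and u: "xc u = of_int m" "dc u = of_int n"
    by (auto elim!: Ints_cases)
  have "real_of_int (m\<^sup>2 - m * n + n\<^sup>2) = 1"
    using norm_coord[of u] \<open>norm u = 1\<close> u by simp
  then have "m\<^sup>2 - m * n + n\<^sup>2 = 1" by linarith
  then consider "m = 1 \<and> n = 0" | "m = -1 \<and> n = 0" | "m = 0 \<and> n = -1" | "m = 0 \<and> n = 1"
    | "m = -1 \<and> n = -1" | "m = 1 \<and> n = 1"
    using int_norm_one[of m n] by auto
  then have "L = loz Lft i (j - 1) \<or> L = loz Lft (i - 1) j \<or> L = loz Ver (i - 1) (j - 1) \<or>
    L = loz Ver i (j + 1) \<or> L = loz Rgt (i - 2) (j - 1) \<or> L = loz Rgt i j"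
  proof cases
    case 1
    then have "L = loz Lft i (j - 1)" using u ij by (auto simp: L rhombus_Lft loz_def)
    then show ?thesis by simp
  next
    case 2
    then have "L = loz Lft (i - 1) j" using u ij by (auto simp: L rhombus_Lft loz_def)
    then show ?thesis by simp
  next
    case 3
    then have "L = loz Ver (i - 1) (j - 1)" using u ij by (auto simp: L rhombus_Ver loz_def sc_def)
    then show ?thesis by simp
  next
    case 4
    then have "L = loz Ver i (j + 1)" using u ij by (auto simp: L rhombus_Ver loz_def sc_def)
    then show ?thesis by simp
  next
    case 5
    then have "L = loz Rgt (i - 2) (j - 1)" using u ij by (auto simp: L rhombus_Rgt loz_def sc_def)
    then show ?thesis by simp
  next
    case 6
    then have "L = loz Rgt i j" using u ij by (auto simp: L rhombus_Rgt loz_def sc_def)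
    then show ?thesis by simp
  qed
  then show "L \<in> {loz t m q | t m q. True}" by blast
next
  fix L assume "L \<in> {loz t m q | t m q. True}"
  then obtain t m q where L: "L = loz t m q" by blast
  have mem: "convex hull (rhombus_corners p u) \<in> lozenges"
    if "(xc u)\<^sup>2 - xc u * dc u + (dc u)\<^sup>2 = 1" "xc u \<in> \<int>" "dc u \<in> \<int>" "xc p \<in> \<int>" "dc p \<in> \<int>" for p u
  proof -
    have "norm u = 1" using norm_coord[of u] that(1) by (simp add: power2_eq_1_iff)
       (metis abs_norm_cancel one_neq_neg_one abs_neg_one abs_1)
    moreover have "rhombus_corners p u \<subseteq> tri_lattice"
      using that by (auto simp: rhombus_corners_def tri_lattice_iff)
    ultimately show ?thesis by (auto simp: lozenges_def)
  qed
  show "L \<in> lozenges"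
  proof (cases t)
    case Lft
    then have "L = convex hull (rhombus_corners (pt m (q + 1)) (pt 1 0))"
      by (auto simp: L rhombus_Lft loz_def)
    then show ?thesis using mem[of "pt 1 0" "pt m (q + 1)"] by simp
  next
    case Rgt
    then have "L = convex hull (rhombus_corners (pt m q) (pt 1 1))"
      by (auto simp: L rhombus_Rgt loz_def sc_def)
    then show ?thesis using mem[of "pt 1 1" "pt m q"] by simp
  next
    case Ver
    then have "L = convex hull (rhombus_corners (pt (m + 1) (q + 1)) (pt 0 (-1)))"
      by (auto simp: L rhombus_Ver loz_def sc_def)
    then show ?thesis using mem[of "pt 0 (-1)" "pt (m + 1) (q + 1)"] by simp
  qed
qed

lemma vertical_lozenge_eq:
  "vertical_lozenge r = {z. xc r - 1 \<le> xc z \<and> xc z \<le> xc r \<and> sc r - 1 \<le> sc z \<and> sc z \<le> sc r}"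
proof -
  have "{r, r + cis (2 * pi / 3), r - 1, r + cis (- 2 * pi / 3)}
    = rhombus_corners (r + cis (- 2 * pi / 3)) (cis (pi / 3))"
  proof -
    have "r + cis (- 2 * pi / 3) + cis (pi / 3) = r"
      "r + cis (- 2 * pi / 3) + cis (pi / 3) + cis (pi / 3) * cis (pi / 3) = r + cis (2 * pi / 3)"
      "r + cis (- 2 * pi / 3) + cis (pi / 3) * cis (pi / 3) = r - 1"
      by (intro coord_eqI; simp del: cis_mult)+
    then show ?thesis unfolding rhombus_corners_def by auto
  qed
  then show ?thesis
    unfolding vertical_lozenge_def by (auto simp: rhombus_Ver sc_def)
qed

text \<open>Vertical positions are defined with an arbitrary complex \<open>r\<close>; the four
  corners force it to be a lattice point.\<close>

lemma vertical_lozenge_in_lozenges: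
  assumes "vertical_lozenge r \<in> lozenges"
  obtains m q where "vertical_lozenge r = loz Ver m q" "xc r = of_int m + 1" "dc r = of_int q"
proof -
  obtain t m q where L: "vertical_lozenge r = loz t m q" using assms by (auto simp: lozenges_eq)
  have "pt (xc r - 1) (dc r - 1) \<in> loz t m q" "pt (xc r) (dc r + 1) \<in> loz t m q"
    "pt (xc r) (dc r) \<in> loz t m q" "pt (xc r - 1) (dc r) \<in> loz t m q"
    unfolding L[symmetric] vertical_lozenge_eq by (auto simp: sc_def)
  then have "t = Ver \<and> xc r = of_int m + 1 \<and> dc r = of_int q"
    by (cases t) (auto simp: loz_def sc_def)
  then show ?thesis using that L by blast
qed

lemma loz_Ver_eq_vertical: "loz Ver m q = vertical_lozenge (pt (of_int m + 1) (of_int q))"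
  by (auto simp: loz_def vertical_lozenge_eq sc_def)

section \<open>The hexagon as a system of inequalities\<close>

lemma mem_convex_segment:
  assumes "convex S" "P \<in> S" "Q \<in> S" "0 \<le> t" "t \<le> 1"
    and "xc z = (1 - t) * xc P + t * xc Q" "dc z = (1 - t) * dc P + t * dc Q"
  shows "z \<in> S"
proof -
  have "z = (1 - t) *\<^sub>R P + t *\<^sub>R Q" using assms by (intro coord_eqI) simp_all
  then show ?thesis using assms by (simp add: convexD)
qed

lemma convex_coord:
  "convex {z. l \<le> xc z}" "convex {z. xc z \<le> l}" "convex {z. l \<le> dc z}" "convex {z. dc z \<le> l}"
  "convex {z. l \<le> sc z}" "convex {z. sc z \<le> l}"
proof -
  have lin: "linear xc" "linear dc" "linear sc"
    by (auto intro!: linearI simp: sc_def algebra_simps)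
  have "convex (f -` {l..})" "convex (f -` {..l})" if "linear f" for f :: "complex \<Rightarrow> real"
    using that by (auto intro!: convex_linear_vimage)
  from this[OF lin(1)] this[OF lin(2)] this[OF lin(3)]
  show "convex {z. l \<le> xc z}" "convex {z. xc z \<le> l}" "convex {z. l \<le> dc z}" "convex {z. dc z \<le> l}"
    "convex {z. l \<le> sc z}" "convex {z. sc z \<le> l}"
    by (simp_all add: vimage_def)
qed

text \<open>For the inclusion from right to left, the horizontal line through \<open>z\<close> meets
  the boundary in two points, each a convex combination of adjacent corners, and \<open>z\<close>
  lies between them.\<close>

lemma hexagon_eq:
  assumes "a > 0" "b > 0" "c > 0"
  shows "hexagon a b c = {z. 0 \<le> xc z \<and> xc z \<le> real b + real c \<and> 0 \<le> dc z \<and> dc z \<le> real a + real c \<and>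
    - real a \<le> sc z \<and> sc z \<le> real b}" (is "_ = ?H")
proof
  have "convex ?H"
    unfolding Collect_conj_eq by (intro convex_Int convex_coord)
  then show "hexagon a b c \<subseteq> ?H"
    unfolding hexagon_def by (intro hull_minimal) (auto simp: sc_def)
next
  let ?P = "\<lambda>x d. pt x d \<in> hexagon a b c"
  have cv: "convex (hexagon a b c)" by (simp add: hexagon_def)
  have hull: "z \<in> hexagon a b c" if "z \<in> {0, of_nat b, of_nat b + of_nat c * cis (- pi / 3),
      of_nat b + of_nat c * cis (- pi / 3) + of_nat a * cis (- 2 * pi / 3),
      of_nat c * cis (- pi / 3) + of_nat a * cis (- 2 * pi / 3),
      of_nat a * cis (- 2 * pi / 3)}" for z
    unfolding hexagon_def using that by (rule hull_inc)
  have "pt 0 0 = 0" "pt b 0 = of_nat b" "pt (b + c) c = of_nat b + of_nat c * cis (- pi / 3)"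
    "pt (b + c) (a + c) = of_nat b + of_nat c * cis (- pi / 3) + of_nat a * cis (- 2 * pi / 3)"
    "pt c (a + c) = of_nat c * cis (- pi / 3) + of_nat a * cis (- 2 * pi / 3)"
    "pt 0 a = of_nat a * cis (- 2 * pi / 3)"
    by (intro coord_eqI; simp)+
  then have corners: "?P 0 0" "?P b 0" "?P (b + c) c" "?P (b + c) (a + c)" "?P c (a + c)" "?P 0 a"
    using hull by simp_all
  show "?H \<subseteq> hexagon a b c"
  proof
    fix z assume z: "z \<in> ?H"
    define x d where "x = xc z" and "d = dc z"
    have zd: "0 \<le> x" "x \<le> real b + real c" "0 \<le> d" "d \<le> real a + real c" "- real a \<le> x - d" "x - d \<le> real b"
      using z by (auto simp: x_def d_def sc_def)
    have left: "?P (max 0 (d - real a)) d"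
    proof (cases "d \<le> a")
      case True
      then show ?thesis
        using assms zd
        by (intro mem_convex_segment[OF cv corners(1) corners(6), of "d / a"]) (auto simp: field_simps)
    next
      case False
      then show ?thesis
        using assms zd
        by (intro mem_convex_segment[OF cv corners(6) corners(5), of "(d - a) / c"]) (auto simp: field_simps)
    qed
    have right: "?P (min (real b + real c) (real b + d)) d"
    proof (cases "d \<le> c")
      case True
      then show ?thesis
        using assms zd
        by (intro mem_convex_segment[OF cv corners(2) corners(3), of "d / c"]) (auto simp: field_simps)
    next
      case False
      then show ?thesis
        using assms zd
        by (intro mem_convex_segment[OF cv corners(3) corners(4), of "(d - c) / a"]) (auto simp: field_simps)
    qed
    define l r where "l = max 0 (d - real a)" and "r = min (real b + real c) (real b + d)"
    have lr: "l < r" "l \<le> x" "x \<le> r" using zd assms by (auto simp: l_def r_def)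
    define t where "t = (x - l) / (r - l)"
    have t: "0 \<le> t" "t \<le> 1" "t * (r - l) = x - l"
      using lr by (simp_all add: t_def)
    show "z \<in> hexagon a b c"
      by (rule mem_convex_segment[OF cv left[folded l_def] right[folded r_def] t(1,2)])
         (use t(3) in \<open>simp_all add: x_def[symmetric] d_def[symmetric] algebra_simps\<close>)
  qed
qed

lemma left_boundary_eq:
  assumes "a > 0" "b > 0" "c > 0" "k \<le> a + c"
  shows "left_boundary a b c k = max 0 (real k - real a) - real k / 2"
proof -
  have xd: "xc (Complex x (line_height k)) = x + real k / 2" "dc (Complex x (line_height k)) = real k" for x
    by (simp_all add: xc_def dc_def line_height_def)
  have "{x. Complex x (line_height k) \<in> hexagon a b c}
    = {max 0 (real k - real a) - real k / 2 .. min (real b + real c) (real b + real k) - real k / 2}"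
    using assms(4) by (auto simp: hexagon_eq[OF assms(1-3)] xd sc_def)
  moreover have "max 0 (real k - real a) - real k / 2 \<le> min (real b + real c) (real b + real k) - real k / 2"
    using assms by auto
  ultimately show ?thesis
    unfolding left_boundary_def by simp
qed


text \<open>Centroids of the two kinds of unit triangles between the lines \<open>q\<close> and \<open>q + 1\<close>. A lozenge is the
  union of two unit triangles, so tilings are exact covers of the centroids in the hexagon.\<close>

definition up :: "int \<Rightarrow> int \<Rightarrow> complex" where
  "up m q = pt (of_int m + 1 / 3) (of_int q + 2 / 3)"

definition dn :: "int \<Rightarrow> int \<Rightarrow> complex" where
  "dn m q = pt (of_int m + 2 / 3) (of_int q + 1 / 3)"

lemma coord_up_dn [simp]:
  "xc (up m q) = of_int m + 1 / 3" "dc (up m q) = of_int q + 2 / 3" "sc (up m q) = of_int (m - q) - 1 / 3"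
  "xc (dn m q) = of_int m + 2 / 3" "dc (dn m q) = of_int q + 1 / 3" "sc (dn m q) = of_int (m - q) + 1 / 3"
  by (simp_all add: up_def dn_def sc_def)

text \<open>The thirds keep centroids off all lattice lines, so weak and strict bounds agree and
  become integer conditions.\<close>

lemma third_bounds:
  fixes i m :: int
  shows "real_of_int m \<le> real_of_int i + 1 / 3 \<longleftrightarrow> m \<le> i" "real_of_int i + 1 / 3 \<le> real_of_int m \<longleftrightarrow> i < m"
    "real_of_int m \<le> real_of_int i + 2 / 3 \<longleftrightarrow> m \<le> i" "real_of_int i + 2 / 3 \<le> real_of_int m \<longleftrightarrow> i < m"
    "real_of_int m \<le> real_of_int i - 1 / 3 \<longleftrightarrow> m < i" "real_of_int i - 1 / 3 \<le> real_of_int m \<longleftrightarrow> i \<le> m"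
    "real_of_int m < real_of_int i + 1 / 3 \<longleftrightarrow> m \<le> i" "real_of_int i + 1 / 3 < real_of_int m \<longleftrightarrow> i < m"
    "real_of_int m < real_of_int i + 2 / 3 \<longleftrightarrow> m \<le> i" "real_of_int i + 2 / 3 < real_of_int m \<longleftrightarrow> i < m"
    "real_of_int m < real_of_int i - 1 / 3 \<longleftrightarrow> m < i" "real_of_int i - 1 / 3 < real_of_int m \<longleftrightarrow> i \<le> m"
  by linarith+

lemma of_int_add_1: "real_of_int i + 1 = real_of_int (i + 1)"
  by simp

lemma dn_in_loz: "dn i j \<in> loz t m q \<longleftrightarrow> i = m \<and> j = q"
  by (cases t) (auto simp: loz_def third_bounds of_int_add_1 simp del: of_int_add of_int_diff)

lemma up_in_loz: "up i j \<in> loz t m q \<longleftrightarrow>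
    (case t of Lft \<Rightarrow> i = m \<and> j = q | Rgt \<Rightarrow> i = m + 1 \<and> j = q | Ver \<Rightarrow> i = m \<and> j = q - 1)"
  by (cases t) (auto simp: loz_def third_bounds of_int_add_1 simp del: of_int_add of_int_diff)

lemma loz_inject: "loz t m q = loz t' m' q' \<longleftrightarrow> t = t' \<and> m = m' \<and> q = q'"
proof
  assume eq: "loz t m q = loz t' m' q'"
  have m: "m = m' \<and> q = q'" using dn_in_loz[of m q t m q] unfolding eq dn_in_loz by simp
  have "up i j \<in> loz t m q \<longleftrightarrow> up i j \<in> loz t' m q" for i j using eq m by simp
  from this[of m q] this[of m "q - 1"] this[of "m + 1" q] m show "t = t' \<and> m = m' \<and> q = q'"
    unfolding up_in_loz by (cases t; cases t') auto
qed simp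

section \<open>Interiors of lozenges and exact covers of centroids\<close>

lemma coord_inner:
  "xc z = Complex 1 (- 1 / sqrt 3) \<bullet> z" "dc z = Complex 0 (- 2 / sqrt 3) \<bullet> z"
  "sc z = Complex 1 (1 / sqrt 3) \<bullet> z"
  by (simp_all add: xc_def dc_def sc_def inner_complex_def field_simps)

lemma interior_strip:
  fixes w :: complex
  assumes "w \<noteq> 0"
  shows "interior {z. l \<le> w \<bullet> z \<and> w \<bullet> z \<le> h} = {z. l < w \<bullet> z \<and> w \<bullet> z < h}"
proof -
  have "{z. l \<le> w \<bullet> z \<and> w \<bullet> z \<le> h} = {z. w \<bullet> z \<ge> l} \<inter> {z. w \<bullet> z \<le> h}" by auto
  then show ?thesis
    using interior_halfspace_ge[OF assms, of l] interior_halfspace_le[OF assms, of h] by auto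
qed

lemma interior_coord_strip:
  "interior {z. l \<le> xc z \<and> xc z \<le> h} = {z. l < xc z \<and> xc z < h}"
  "interior {z. l \<le> dc z \<and> dc z \<le> h} = {z. l < dc z \<and> dc z < h}"
  "interior {z. l \<le> sc z \<and> sc z \<le> h} = {z. l < sc z \<and> sc z < h}"
  unfolding coord_inner by (rule interior_strip; simp add: complex_eq_iff)+

lemma interior_loz: "interior (loz t m q) =
    {z. (t \<noteq> Rgt \<longrightarrow> of_int m < xc z \<and> xc z < of_int m + 1) \<and>
     (t \<noteq> Ver \<longrightarrow> of_int q < dc z \<and> dc z < of_int q + 1) \<and>
     (t \<noteq> Lft \<longrightarrow> of_int (m - q) < sc z \<and> sc z < of_int (m - q) + 1)}"
proof -
  let ?X = "{z. of_int m \<le> xc z \<and> xc z \<le> of_int m + 1}"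
  let ?D = "{z. of_int q \<le> dc z \<and> dc z \<le> of_int q + 1}"
  let ?S = "{z. of_int (m - q) \<le> sc z \<and> sc z \<le> of_int (m - q) + 1}"
  have "loz t m q = (case t of Lft \<Rightarrow> ?X \<inter> ?D | Rgt \<Rightarrow> ?D \<inter> ?S | Ver \<Rightarrow> ?X \<inter> ?S)"
    by (cases t) (auto simp: loz_def)
  then show ?thesis
    by (cases t) (auto simp: interior_coord_strip)
qed

lemma dn_in_interior_loz: "dn i j \<in> interior (loz t m q) \<longleftrightarrow> dn i j \<in> loz t m q"
  unfolding dn_in_loz
  by (cases t) (auto simp: interior_loz third_bounds of_int_add_1 simp del: of_int_add of_int_diff)

lemma up_in_interior_loz: "up i j \<in> interior (loz t m q) \<longleftrightarrow> up i j \<in> loz t m q"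
  unfolding up_in_loz
  by (cases t) (auto simp: interior_loz third_bounds of_int_add_1 simp del: of_int_add of_int_diff)

lemma interior_loz_bounds:
  assumes "z \<in> interior (loz t m q)"
  shows "real_of_int m < xc z \<and> xc z < of_int (m + (if t = Rgt then 2 else 1)) \<and>
    of_int (q - (if t = Ver then 1 else 0)) < dc z \<and> dc z < of_int (q + 1) \<and>
    of_int (m - q - (if t = Lft then 1 else 0)) < sc z \<and> sc z < of_int (m - q + 1)"
  using assms by (cases t) (auto simp: interior_loz sc_def)

text \<open>Strict bounds on all three coordinates leave few integer offsets; for each, the two
  downward or the two upward triangles coincide.\<close>

lemma interior_loz_meet:
  assumes "z \<in> interior (loz t m q)" "z \<in> interior (loz t' m' q')"
  shows "\<exists>i j. dn i j \<in> loz t m q \<inter> loz t' m' q' \<or> up i j \<in> loz t m q \<inter> loz t' m' q'"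
proof -
  have "m < m' + (if t' = Rgt then 2 else 1)" "m' < m + (if t = Rgt then 2 else 1)"
    "q - (if t = Ver then 1 else 0) < q' + 1" "q' - (if t' = Ver then 1 else 0) < q + 1"
    "m - q - (if t = Lft then 1 else 0) < m' - q' + 1" "m' - q' - (if t' = Lft then 1 else 0) < m - q + 1"
    using interior_loz_bounds[OF assms(1)] interior_loz_bounds[OF assms(2)]
    unfolding of_int_less_iff[symmetric, where 'a = real] by (blast intro: less_trans)+
  then have "m = m' \<and> q = q' \<or>
    (if t = Rgt then m + 1 else m) = (if t' = Rgt then m' + 1 else m') \<and>
    (if t = Ver then q - 1 else q) = (if t' = Ver then q' - 1 else q')"
    by (cases t; cases t') (simp_all, presburger+)
  then show ?thesis
  proof
    assume "m = m' \<and> q = q'"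
    then have "dn m q \<in> loz t m q \<inter> loz t' m' q'" by (simp add: dn_in_loz)
    then show ?thesis by blast
  next
    assume "(if t = Rgt then m + 1 else m) = (if t' = Rgt then m' + 1 else m') \<and>
      (if t = Ver then q - 1 else q) = (if t' = Ver then q' - 1 else q')"
    then have "up (if t = Rgt then m + 1 else m) (if t = Ver then q - 1 else q) \<in> loz t m q \<inter> loz t' m' q'"
      unfolding up_in_loz Int_iff by (cases t; cases t'; simp)
    then show ?thesis by blast
  qed
qed

lemma finite_lozenge_set:
  assumes "T \<subseteq> lozenges" "\<And>L. L \<in> T \<Longrightarrow> \<exists>i j. i \<in> I \<and> j \<in> J \<and> dn i j \<in> L" "finite I" "finite J"
  shows "finite T"
proof (rule finite_subset)
  show "T \<subseteq> (\<lambda>(t, i, j). loz t i j) ` ({Lft, Rgt, Ver} \<times> I \<times> J)"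
  proof
    fix L assume "L \<in> T"
    then obtain t m q where L: "L = loz t m q" using assms(1) by (auto simp: lozenges_eq)
    then have "m \<in> I" "q \<in> J" using assms(2)[OF \<open>L \<in> T\<close>] by (auto simp: dn_in_loz)
    moreover have "t \<in> {Lft, Rgt, Ver}" by (cases t) auto
    ultimately show "L \<in> (\<lambda>(t, i, j). loz t i j) ` ({Lft, Rgt, Ver} \<times> I \<times> J)" using L by force
  qed
qed (use assms in simp)

definition centroids :: "complex set" where
  "centroids = {dn i j | i j. True} \<union> {up i j | i j. True}"

lemma centroid_in_interior:
  assumes "L \<in> lozenges" "z \<in> centroids"
  shows "z \<in> interior L \<longleftrightarrow> z \<in> L"
  using assms by (auto simp: lozenges_eq centroids_def dn_in_interior_loz up_in_interior_loz)

context
  fixes a b c :: nat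
  assumes pos: "a > 0" "b > 0" "c > 0"
begin

lemma mem_hexagon_int: "z \<in> hexagon a b c \<longleftrightarrow>
    of_int 0 \<le> xc z \<and> xc z \<le> of_int (int b + int c) \<and> of_int 0 \<le> dc z \<and> dc z \<le> of_int (int a + int c) \<and>
    of_int (- int a) \<le> sc z \<and> sc z \<le> of_int (int b)"
  by (simp add: hexagon_eq[OF pos])

lemma dn_in_hexagon: "dn i j \<in> hexagon a b c \<longleftrightarrow>
    0 \<le> i \<and> i < int b + int c \<and> 0 \<le> j \<and> j < int a + int c \<and> - int a \<le> i - j \<and> i - j < int b"
  unfolding mem_hexagon_int coord_up_dn third_bounds ..

lemma up_in_hexagon: "up i j \<in> hexagon a b c \<longleftrightarrow>
    0 \<le> i \<and> i < int b + int c \<and> 0 \<le> j \<and> j < int a + int c \<and> - int a < i - j \<and> i - j \<le> int b"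
  unfolding mem_hexagon_int coord_up_dn third_bounds ..

lemma hexagon_interior: "interior (hexagon a b c) =
   {z. 0 < xc z \<and> xc z < real b + real c \<and> 0 < dc z \<and> dc z < real a + real c \<and> - real a < sc z \<and> sc z < real b}"
proof -
  have "hexagon a b c = {z. 0 \<le> xc z \<and> xc z \<le> real b + real c} \<inter> {z. 0 \<le> dc z \<and> dc z \<le> real a + real c}
     \<inter> {z. - real a \<le> sc z \<and> sc z \<le> real b}"
    unfolding hexagon_eq[OF pos] by auto
  then show ?thesis by (auto simp: interior_coord_strip)
qed

text \<open>A convex set with nonempty interior lies in the closure of its interior, so boundary
  points need no separate cover.\<close>

lemma hexagon_subset_closed:
  assumes "closed F" "interior (hexagon a b c) \<subseteq> F"
  shows "hexagon a b c \<subseteq> F"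
proof -
  have "pt (1/2) (1/2) \<in> interior (hexagon a b c)"
    using pos by (auto simp: hexagon_interior sc_def)
  then have "closure (interior (hexagon a b c)) = closure (hexagon a b c)"
    by (intro convex_closure_interior) (auto simp: hexagon_def)
  then show ?thesis
    using closure_minimal[OF assms(2,1)] closure_subset[of "hexagon a b c"] by simp
qed

text \<open>The sides of the hexagon lie on lattice lines, so a unit triangle with its centroid
  inside lies inside.\<close>

lemma loz_subset_hexagon:
  assumes "\<And>i j. dn i j \<in> loz t m q \<Longrightarrow> dn i j \<in> hexagon a b c"
    "\<And>i j. up i j \<in> loz t m q \<Longrightarrow> up i j \<in> hexagon a b c"
  shows "loz t m q \<subseteq> hexagon a b c"
proof
  fix z assume z: "z \<in> loz t m q"
  have d: "dn m q \<in> hexagon a b c" using assms(1) by (simp add: dn_in_loz)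
  have u: "up (if t = Rgt then m + 1 else m) (if t = Ver then q - 1 else q) \<in> hexagon a b c"
    by (rule assms(2)) (cases t; simp add: up_in_loz)
  have di: "0 \<le> m" "m + 1 \<le> int b + int c" "0 \<le> q" "q + 1 \<le> int a + int c" "- int a \<le> m - q" "m - q + 1 \<le> int b"
    using d by (simp_all add: dn_in_hexagon)
  then have dr: "0 \<le> real_of_int m" "real_of_int m + 1 \<le> real b + real c" "0 \<le> real_of_int q"
    "real_of_int q + 1 \<le> real a + real c" "- real a \<le> real_of_int m - real_of_int q"
    "real_of_int m - real_of_int q + 1 \<le> real b"
    by linarith+
  show "z \<in> hexagon a b c"
  proof (cases t)
    case Lft
    then have "- int a + 1 \<le> m - q" using u by (simp add: up_in_hexagon)
    then have "- real a + 1 \<le> real_of_int m - real_of_int q" by linarith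
    then show ?thesis using z dr Lft by (auto simp: loz_def hexagon_eq[OF pos] sc_def)
  next
    case Rgt
    then have "m + 2 \<le> int b + int c" using u by (simp add: up_in_hexagon)
    then have "real_of_int m + 2 \<le> real b + real c" by linarith
    then show ?thesis using z dr Rgt by (auto simp: loz_def hexagon_eq[OF pos] sc_def)
  next
    case Ver
    then have "1 \<le> q" using u by (simp add: up_in_hexagon)
    then have "1 \<le> real_of_int q" by linarith
    then show ?thesis using z dr Ver by (auto simp: loz_def hexagon_eq[OF pos] sc_def)
  qed
qed

text \<open>Rounding down \<open>xc\<close> and \<open>dc\<close> selects a unit parallelogram,
  whose diagonal \<open>sc = i - j\<close> separates the two triangles. Strict bounds on
  \<open>z\<close> keep the selected one in the hexagon.\<close>

lemma interior_hexagon_cases: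
  assumes "z \<in> interior (hexagon a b c)"
  obtains i j where "dn i j \<in> hexagon a b c" "\<And>t m q. dn i j \<in> loz t m q \<Longrightarrow> z \<in> loz t m q"
  | i j where "up i j \<in> hexagon a b c" "\<And>t m q. up i j \<in> loz t m q \<Longrightarrow> z \<in> loz t m q"
proof -
  define i j where "i = \<lfloor>xc z\<rfloor>" and "j = \<lfloor>dc z\<rfloor>"
  have ij: "of_int i \<le> xc z" "xc z < of_int i + 1" "of_int j \<le> dc z" "dc z < of_int j + 1"
    unfolding i_def j_def by linarith+
  have z: "0 < xc z" "xc z < real b + real c" "0 < dc z" "dc z < real a + real c"
    "- real a < xc z - dc z" "xc z - dc z < real b"
    using assms by (auto simp: hexagon_interior sc_def)
  have bd: "0 \<le> i" "i < int b + int c" "0 \<le> j" "j < int a + int c"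
    using ij z by linarith+
  show ?thesis
  proof (cases "xc z - dc z \<le> of_int (i - j)")
    case True
    then have "- int a < i - j" "i - j \<le> int b" using ij z by linarith+
    then have "up i j \<in> hexagon a b c" using bd by (simp add: up_in_hexagon)
    moreover have "z \<in> loz t m q" if "up i j \<in> loz t m q" for t m q
      using that[unfolded up_in_loz] ij True by (cases t) (auto simp: loz_def sc_def)
    ultimately show ?thesis using that(2) by blast
  next
    case False
    then have "- int a \<le> i - j" "i - j < int b" using ij z by linarith+
    then have "dn i j \<in> hexagon a b c" using bd by (simp add: dn_in_hexagon)
    moreover have "z \<in> loz t m q" if "dn i j \<in> loz t m q" for t m q
      using that[unfolded dn_in_loz] ij False by (cases t) (auto simp: loz_def sc_def)
    ultimately show ?thesis using that(1) by blast
  qed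
qed

text \<open>A centroid in a lozenge is interior to it, so disjoint interiors make covers unique.
  Conversely, overlapping interiors would share a centroid, and covered centroids bring their whole
  triangles.\<close>

lemma lozenge_tiling_hexagon_iff:
  "lozenge_tiling (hexagon a b c) T \<longleftrightarrow> T \<subseteq> lozenges \<and>
     (\<forall>z\<in>centroids. (z \<in> hexagon a b c \<longrightarrow> (\<exists>!L. L \<in> T \<and> z \<in> L)) \<and> (\<forall>L\<in>T. z \<in> L \<longrightarrow> z \<in> hexagon a b c))"
    (is "_ \<longleftrightarrow> _ \<and> ?R")
proof
  assume T: "lozenge_tiling (hexagon a b c) T"
  then have sub: "T \<subseteq> lozenges" and un: "\<Union>T = hexagon a b c"
    and pw: "\<And>L L'. L \<in> T \<Longrightarrow> L' \<in> T \<Longrightarrow> L \<noteq> L' \<Longrightarrow> interior L \<inter> interior L' = {}"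
    by (auto simp: lozenge_tiling_def pairwise_def)
  have "L = L'" if "z \<in> centroids" "L \<in> T" "z \<in> L" "L' \<in> T" "z \<in> L'" for z L L'
  proof (rule ccontr)
    assume "L \<noteq> L'"
    then have "z \<notin> interior L \<inter> interior L'" using pw that by simp
    moreover have "L \<in> lozenges" "L' \<in> lozenges" using that sub by auto
    ultimately show False using centroid_in_interior that by simp
  qed
  note unique = this
  show "T \<subseteq> lozenges \<and> ?R"
  proof (intro conjI ballI impI sub)
    fix z assume z: "z \<in> centroids"
    show "\<exists>!L. L \<in> T \<and> z \<in> L" if "z \<in> hexagon a b c"
      using that unique[OF z] unfolding un[symmetric] by blast
    show "z \<in> hexagon a b c" if "L \<in> T" "z \<in> L" for L
      using that unfolding un[symmetric] by blast
  qed
next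
  assume "T \<subseteq> lozenges \<and> ?R"
  then have sub: "T \<subseteq> lozenges" and ex1: "\<And>z. z \<in> centroids \<Longrightarrow> z \<in> hexagon a b c \<Longrightarrow> \<exists>!L. L \<in> T \<and> z \<in> L"
    and inH: "\<And>z L. z \<in> centroids \<Longrightarrow> L \<in> T \<Longrightarrow> z \<in> L \<Longrightarrow> z \<in> hexagon a b c" by blast+
  have cen: "dn i j \<in> centroids" "up i j \<in> centroids" for i j by (auto simp: centroids_def)
  have shape: "\<exists>t m q. L = loz t m q" if "L \<in> T" for L using that sub by (auto simp: lozenges_eq)
  have subH: "L \<subseteq> hexagon a b c" if LT: "L \<in> T" for L
  proof -
    obtain t m q where L: "L = loz t m q" using shape[OF LT] by blast
    show ?thesis
      unfolding L by (rule loz_subset_hexagon) (use inH[OF cen(1) LT] inH[OF cen(2) LT] L in auto)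
  qed
  \<comment> \<open>Finiteness makes the union closed, so covering the interior of the hexagon is
    enough.\<close>
  have "finite T"
  proof (rule finite_lozenge_set[OF sub, of "{0..<int b + int c}" "{0..<int a + int c}"])
    fix L assume L: "L \<in> T"
    then obtain t m q where "L = loz t m q" using shape[OF L] by blast
    then have dn: "dn m q \<in> L" by (simp add: dn_in_loz)
    then have "dn m q \<in> hexagon a b c" using inH[OF cen(1) L] by blast
    then show "\<exists>i j. i \<in> {0..<int b + int c} \<and> j \<in> {0..<int a + int c} \<and> dn i j \<in> L"
      using dn by (auto simp: dn_in_hexagon)
  qed auto
  moreover have "closed L" if "L \<in> T" for L
  proof -
    have "L \<in> lozenges" using that sub by blast
    then show ?thesis
      unfolding lozenges_def rhombus_corners_def
      by (auto intro!: compact_imp_closed finite_imp_compact_convex_hull)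
  qed
  ultimately have cl: "closed (\<Union>T)" by blast
  have "hexagon a b c \<subseteq> \<Union>T"
  proof (rule hexagon_subset_closed[OF cl], rule subsetI)
    fix z assume "z \<in> interior (hexagon a b c)"
    then show "z \<in> \<Union>T"
    proof (cases rule: interior_hexagon_cases)
      case (1 i j)
      obtain L where "L \<in> T" "dn i j \<in> L" using ex1[OF cen(1) 1(1)] by blast
      moreover obtain t m q where "L = loz t m q" using shape[OF \<open>L \<in> T\<close>] by blast
      ultimately show ?thesis using 1(2) by blast
    next
      case (2 i j)
      obtain L where "L \<in> T" "up i j \<in> L" using ex1[OF cen(2) 2(1)] by blast
      moreover obtain t m q where "L = loz t m q" using shape[OF \<open>L \<in> T\<close>] by blast
      ultimately show ?thesis using 2(2) by blast
    qed
  qed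
  moreover have "interior L \<inter> interior L' = {}" if LL: "L \<in> T" "L' \<in> T" "L \<noteq> L'" for L L'
  proof (rule ccontr)
    assume "interior L \<inter> interior L' \<noteq> {}"
    then obtain z where z: "z \<in> interior L" "z \<in> interior L'" by blast
    obtain t m q where L: "L = loz t m q" using shape[OF LL(1)] by blast
    obtain t' m' q' where L': "L' = loz t' m' q'" using shape[OF LL(2)] by blast
    obtain y where y: "y \<in> centroids" "y \<in> L" "y \<in> L'"
      using interior_loz_meet[OF z[unfolded L L']] cen unfolding L L' by blast
    then show False using ex1[OF y(1) inH[OF y(1) LL(1) y(2)]] LL by blast
  qed
  moreover have "\<Union>T \<subseteq> hexagon a b c" by (rule Union_least) (rule subH)
  ultimately show "lozenge_tiling (hexagon a b c) T"
    using sub unfolding lozenge_tiling_def pairwise_def by blast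
qed

end

section \<open>Tilings as chains\<close>

lemma Ex1_iff_card_eq_1: "(\<exists>!x. x \<in> S) \<longleftrightarrow> card S = 1"
  unfolding is_singleton_altdef[symmetric] is_singleton_def by blast

lemma card_Int_three:
  assumes "x \<noteq> y" "x \<noteq> z" "y \<noteq> z"
  shows "int (card ({x, y, z} \<inter> T)) = of_bool (x \<in> T) + of_bool (y \<in> T) + of_bool (z \<in> T)"
  using assms by (cases "x \<in> T"; cases "y \<in> T"; cases "z \<in> T") (simp_all add: Int_insert_left card_insert_if)

text \<open>Exact covering becomes an integer equation between indicators, so that equations of
  neighbouring triangles can be subtracted.\<close>

lemma exactly_one_of_three:
  assumes iff: "\<And>L. L \<in> T \<Longrightarrow> z \<in> L \<longleftrightarrow> L = A \<or> L = B \<or> L = C" and ne: "A \<noteq> B" "A \<noteq> C" "B \<noteq> C"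
  shows "of_bool (A \<in> T) + of_bool (B \<in> T) + of_bool (C \<in> T) = (of_bool P :: int) \<longleftrightarrow>
    (P \<longrightarrow> (\<exists>!L. L \<in> T \<and> z \<in> L)) \<and> (\<forall>L\<in>T. z \<in> L \<longrightarrow> P)"
proof -
  define S where "S = {L \<in> T. z \<in> L}"
  have mem: "L \<in> S \<longleftrightarrow> L \<in> T \<and> z \<in> L" for L by (simp add: S_def)
  have S: "S = {A, B, C} \<inter> T" using iff unfolding S_def by blast
  have fin: "finite S" unfolding S by simp
  have card: "of_bool (A \<in> T) + of_bool (B \<in> T) + of_bool (C \<in> T) = int (card S)"
    unfolding S card_Int_three[OF ne] ..
  have ex1: "(\<exists>!L. L \<in> T \<and> z \<in> L) \<longleftrightarrow> card S = 1"
    unfolding Ex1_iff_card_eq_1[symmetric] mem ..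
  have ball: "(\<forall>L\<in>T. z \<in> L \<longrightarrow> P) \<longleftrightarrow> P \<or> card S = 0"
    unfolding card_0_eq[OF fin] by (auto simp: S_def)
  show ?thesis unfolding card ex1 ball by (cases P) simp_all
qed

text \<open>The elements of \<open>C\<close> that a step to \<open>D\<close> increases; they are determined by \<open>C\<close> and \<open>D\<close>.\<close>

definition moves :: "int set \<Rightarrow> int set \<Rightarrow> int set" where
  "moves C D = {m. below D (m + 1) < below C (m + 1)}"

text \<open>The indicator of a move at \<open>m\<close> is the difference of the counts at
  \<open>m + 1\<close>. The identity is a conservation law: occupied after = occupied before -
  departures + arrivals.\<close>

lemma step_moves:
  assumes "step C D" "finite C" "finite D"
  shows "moves C D \<subseteq> C"
    and "of_bool (m \<in> D) = (of_bool (m \<in> C) - of_bool (m \<in> moves C D) + of_bool (m - 1 \<in> moves C D) :: int)"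
proof -
  have st: "below D m \<le> below C m" "below C m \<le> below D (m + 1)" for m
    using assms(1) by (auto simp: step_def)
  have M: "of_bool (m \<in> moves C D) = below C (m + 1) - below D (m + 1)" for m
    using st[of m] st[of "m + 1"] below_Suc[OF assms(2), of m] by (cases "m \<in> C") (auto simp: moves_def)
  show "moves C D \<subseteq> C"
  proof
    fix m assume "m \<in> moves C D"
    then show "m \<in> C" using st[of m] below_Suc[OF assms(2), of m] by (cases "m \<in> C") (auto simp: moves_def)
  qed
  show "of_bool (m \<in> D) = (of_bool (m \<in> C) - of_bool (m \<in> moves C D) + of_bool (m - 1 \<in> moves C D) :: int)"
    using below_Suc[OF assms(2), of m] below_Suc[OF assms(3), of m] M[of m] M[of "m - 1"] by simp
qed

text \<open>Summing the conservation law from the far left telescopes and leaves only the move at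
  \<open>m - 1\<close>.\<close>

lemma moves_unique:
  assumes fin: "finite C" "finite D" and "M \<subseteq> C"
    and ind: "\<And>m. of_bool (m \<in> D) = (of_bool (m \<in> C) - of_bool (m \<in> M) + of_bool (m - 1 \<in> M) :: int)"
  shows "step C D" "moves C D = M"
proof -
  \<comment> \<open>The element 0 keeps \<open>Min\<close> meaningful when both sets are
    empty.\<close>
  define L where "L = Min (insert 0 (C \<union> D))"
  have L: "L \<le> x" if "x \<in> C \<or> x \<in> D" for x
    using that fin by (auto simp: L_def)
  have diff: "below D m = below C m - of_bool (m - 1 \<in> M)" for m
  proof (cases "m \<le> L")
    case True
    then have "m - 1 \<notin> M" using L[of "m - 1"] assms(3) by auto
    moreover have "C \<subseteq> {m..}" "D \<subseteq> {m..}" using True L by force+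
    then have "below C m = 0" "below D m = 0" using fin by (simp_all add: below_eq_0_iff)
    ultimately show ?thesis by simp
  next
    case False
    then have "L \<le> m" by simp
    then show ?thesis
    proof (induction m rule: int_ge_induct)
      case base
      have "L - 1 \<notin> M" using L[of "L - 1"] assms(3) by auto
      moreover have "C \<subseteq> {L..}" "D \<subseteq> {L..}" using L by auto
      then have "below C L = 0" "below D L = 0" using fin by (simp_all add: below_eq_0_iff)
      ultimately show ?case by simp
    next
      case (step m)
      then show ?case using ind[of m] below_Suc[OF fin(1), of m] below_Suc[OF fin(2), of m] by simp
    qed
  qed
  show "step C D"
    unfolding step_def
  proof (intro allI conjI)
    fix m
    show "below D m \<le> below C m" by (simp add: diff)
    show "below C m \<le> below D (m + 1)"
      using diff[of "m + 1"] below_Suc[OF fin(1), of m] assms(3) by (cases "m \<in> M") auto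
  qed
  show "moves C D = M"
    by (auto simp: moves_def diff)
qed

lemma step_backward_subset:
  assumes "step C D" "finite C" "finite D" "D \<subseteq> {s..<t}"
  shows "C \<subseteq> {s - 1..<t}"
proof -
  have "step D ((+) 1 ` C)" using assms by (simp add: step_reverse)
  from step_forward_subset[OF this assms(3) _ assms(4)] show ?thesis
    using assms(2) by auto
qed

lemma chains_backward_subset:
  assumes "C \<in> chains n X Y" "Y \<subseteq> {s..<t}" "j \<le> n"
  shows "C (n - j) \<subseteq> {s - int j..<t}"
  using assms(3)
proof (induction j)
  case 0
  then show ?case using assms by (simp add: chains_def)
next
  case (Suc j)
  then have "n - j = Suc (n - Suc j)" by simp
  then have "step (C (n - Suc j)) (C (n - j))" "finite (C (n - Suc j))" "finite (C (n - j))"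
    using assms(1) Suc.prems by (auto simp: chains_def)
  from step_backward_subset[OF this, of "s - int j" t] show ?case
    using Suc by (simp add: algebra_simps)
qed

section \<open>The bijection between tilings and chains\<close>

context
  fixes a b c :: nat
  assumes pos: "a > 0" "b > 0" "c > 0"
begin

text \<open>Left end points, in the coordinate \<open>xc\<close>, of the unit segments in which line
  \<open>j\<close> meets the hexagon.\<close>

definition line :: "int \<Rightarrow> int set" where
  "line j = {max 0 (j - int a)..<int b + min j (int c)}"

abbreviation "hexchains \<equiv> chains (a + c) {0..<int b} {int c..<int c + int b}"

lemma dn_in_hexagon_line: "dn m q \<in> hexagon a b c \<longleftrightarrow> 0 \<le> q \<and> q < int a + int c \<and> m \<in> line q"
  by (auto simp: dn_in_hexagon[OF pos] line_def)

lemma up_in_hexagon_line: "up m q \<in> hexagon a b c \<longleftrightarrow> 0 \<le> q \<and> q < int a + int c \<and> m \<in> line (q + 1)"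
  by (auto simp: up_in_hexagon[OF pos] line_def)

lemma line_bottom: "line (int a + int c) = {int c..<int c + int b}"
  by (auto simp: line_def)

lemma line_top: "line 0 = {0..<int b}"
  by (auto simp: line_def)

text \<open>The forward window from the top and the backward window from the bottom intersect
  exactly in the line.\<close>

lemma hexchains_subset_line:
  assumes "C \<in> hexchains" "j \<le> a + c"
  shows "C j \<subseteq> line (int j)"
proof -
  have "C j \<subseteq> {0..<int b + int j}"
    using chains_card_subset[OF assms(1), of 0 "int b" j] assms(2) by simp
  moreover have "C j \<subseteq> {int j - int a..<int c + int b}"
    using chains_backward_subset[OF assms(1) subset_refl, of "a + c - j"] assms(2)
    by (simp add: of_nat_diff)
  moreover have "{0..<int b + int j} \<inter> {int j - int a..<int c + int b} = line (int j)"
    by (auto simp: line_def)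
  ultimately show ?thesis by blast
qed

text \<open>Each sum runs over the three lozenges containing one triangle. A downward triangle hangs
  from a segment of line \<open>q\<close>, an upward one stands on a segment of line
  \<open>q + 1\<close>, hence the shifted indices.\<close>

definition covers :: "complex set set \<Rightarrow> bool" where
  "covers T \<longleftrightarrow> (\<forall>m q.
     of_bool (loz Lft m q \<in> T) + of_bool (loz Rgt m q \<in> T) + of_bool (loz Ver m q \<in> T)
       = (of_bool (dn m q \<in> hexagon a b c) :: int) \<and>
     of_bool (loz Lft m q \<in> T) + of_bool (loz Rgt (m - 1) q \<in> T) + of_bool (loz Ver m (q + 1) \<in> T)
       = (of_bool (up m q \<in> hexagon a b c) :: int))"

lemma lozenge_tiling_iff_covers:
  "lozenge_tiling (hexagon a b c) T \<longleftrightarrow> T \<subseteq> lozenges \<and> covers T"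
proof (cases "T \<subseteq> lozenges")
  case True
  have shape: "\<exists>t m q. L = loz t m q" if "L \<in> T" for L using that True by (auto simp: lozenges_eq)
  have dn: "dn m q \<in> L \<longleftrightarrow> L = loz Lft m q \<or> L = loz Rgt m q \<or> L = loz Ver m q" if LT: "L \<in> T" for L m q
  proof -
    obtain t i j where L: "L = loz t i j" using shape[OF LT] by blast
    show ?thesis unfolding L dn_in_loz loz_inject by (cases t) auto
  qed
  have up: "up m q \<in> L \<longleftrightarrow> L = loz Lft m q \<or> L = loz Rgt (m - 1) q \<or> L = loz Ver m (q + 1)" if LT: "L \<in> T" for L m q
  proof -
    obtain t i j where L: "L = loz t i j" using shape[OF LT] by blast
    show ?thesis unfolding L up_in_loz loz_inject by (cases t) auto
  qed
  have dn_sum: "of_bool (loz Lft m q \<in> T) + of_bool (loz Rgt m q \<in> T) + of_bool (loz Ver m q \<in> T)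
      = (of_bool P :: int) \<longleftrightarrow> (P \<longrightarrow> (\<exists>!L. L \<in> T \<and> dn m q \<in> L)) \<and> (\<forall>L\<in>T. dn m q \<in> L \<longrightarrow> P)" for m q P
    by (rule exactly_one_of_three[OF dn]) (simp_all add: loz_inject)
  have up_sum: "of_bool (loz Lft m q \<in> T) + of_bool (loz Rgt (m - 1) q \<in> T) + of_bool (loz Ver m (q + 1) \<in> T)
      = (of_bool P :: int) \<longleftrightarrow> (P \<longrightarrow> (\<exists>!L. L \<in> T \<and> up m q \<in> L)) \<and> (\<forall>L\<in>T. up m q \<in> L \<longrightarrow> P)" for m q P
    by (rule exactly_one_of_three[OF up]) (simp_all add: loz_inject)
  have ball: "(\<forall>z\<in>centroids. Q z) \<longleftrightarrow> (\<forall>m q. Q (dn m q) \<and> Q (up m q))" for Q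
    unfolding centroids_def by blast
  show ?thesis
    unfolding lozenge_tiling_hexagon_iff[OF pos] covers_def dn_sum up_sum ball
    using True by (simp only: simp_thms)
next
  case False
  then show ?thesis by (simp add: lozenge_tiling_hexagon_iff[OF pos])
qed

text \<open>Occupied segments are read off from the lozenges just below a line; the bottom line has
  none, so its set is prescribed.\<close>

definition chain_of_tiling :: "complex set set \<Rightarrow> nat \<Rightarrow> int set" where
  "chain_of_tiling T j = (if j < a + c then {m. loz Lft m (int j) \<in> T \<or> loz Rgt m (int j) \<in> T}
     else if j = a + c then {int c..<int c + int b} else {})"

definition in_tiling :: "(nat \<Rightarrow> int set) \<Rightarrow> shape \<Rightarrow> int \<Rightarrow> int \<Rightarrow> bool" where
  "in_tiling C t m q \<longleftrightarrow> 0 \<le> q \<and> q < int a + int c \<and>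
     (case t of
        Rgt \<Rightarrow> m \<in> moves (C (nat q)) (C (Suc (nat q)))
      | Lft \<Rightarrow> m \<in> C (nat q) \<and> m \<notin> moves (C (nat q)) (C (Suc (nat q)))
      | Ver \<Rightarrow> m \<in> line q \<and> m \<notin> C (nat q))"

definition tiling_of_chain :: "(nat \<Rightarrow> int set) \<Rightarrow> complex set set" where
  "tiling_of_chain C = {loz t m q | t m q. in_tiling C t m q}"

lemma loz_in_tiling_of_chain: "loz t m q \<in> tiling_of_chain C \<longleftrightarrow> in_tiling C t m q"
  by (auto simp: tiling_of_chain_def loz_inject)

text \<open>Below a line each segment moves, stays or is a gap; above it the conservation law counts
  the arrivals, and gaps receive vertical lozenges. The full end lines let no vertical lozenge stick
  out.\<close>

lemma tiling_of_chain_tiling: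
  assumes C: "C \<in> hexchains"
  shows "lozenge_tiling (hexagon a b c) (tiling_of_chain C)"
  unfolding lozenge_tiling_iff_covers
proof
  show "tiling_of_chain C \<subseteq> lozenges" by (auto simp: tiling_of_chain_def lozenges_eq)
  have st: "step (C j) (C (Suc j))" "finite (C j)" if "j < a + c" for j
    using C that by (auto simp: chains_def)
  have fin: "finite (C j)" for j using C by (auto simp: chains_def)
  have ends: "C 0 = {0..<int b}" "C (a + c) = {int c..<int c + int b}" using C by (auto simp: chains_def)
  show "covers (tiling_of_chain C)"
    unfolding covers_def loz_in_tiling_of_chain
  proof (intro allI conjI)
    fix m q
    show "of_bool (in_tiling C Lft m q) + of_bool (in_tiling C Rgt m q) + of_bool (in_tiling C Ver m q)
       = (of_bool (dn m q \<in> hexagon a b c) :: int)"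
    proof (cases "0 \<le> q \<and> q < int a + int c")
      case True
      define j where "j = nat q"
      have j: "q = int j" "j < a + c" using True by (auto simp: j_def)
      have "moves (C j) (C (Suc j)) \<subseteq> C j" by (rule step_moves(1)[OF st(1)[OF j(2)] fin fin])
      then show ?thesis
        using hexchains_subset_line[OF C, of j] j
        by (auto simp: in_tiling_def dn_in_hexagon_line)
    qed (auto simp: in_tiling_def dn_in_hexagon_line)
    show "of_bool (in_tiling C Lft m q) + of_bool (in_tiling C Rgt (m - 1) q) + of_bool (in_tiling C Ver m (q + 1))
       = (of_bool (up m q \<in> hexagon a b c) :: int)"
    proof (cases "0 \<le> q \<and> q < int a + int c")
      case True
      define j where "j = nat q"
      have j: "q = int j" "j < a + c" using True by (auto simp: j_def)
      have nj: "nat (q + 1) = Suc j" using j by simp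
      let ?M = "moves (C j) (C (Suc j))"
      have sub: "?M \<subseteq> C j" by (rule step_moves(1)[OF st(1)[OF j(2)] fin fin])
      have D: "of_bool (m \<in> C (Suc j)) = (of_bool (m \<in> C j) - of_bool (m \<in> ?M) + of_bool (m - 1 \<in> ?M) :: int)"
        by (rule step_moves(2)[OF st(1)[OF j(2)] fin fin])
      have "of_bool (in_tiling C Lft m q) + of_bool (in_tiling C Rgt (m - 1) q) = (of_bool (m \<in> C (Suc j)) :: int)"
        using D sub j by (auto simp: in_tiling_def)
      moreover have "of_bool (m \<in> C (Suc j)) + of_bool (in_tiling C Ver m (q + 1)) = (of_bool (m \<in> line (q + 1)) :: int)"
      proof (cases "Suc j = a + c")
        case True
        then have "q + 1 = int a + int c" using j by simp
        then show ?thesis using ends(2) True by (simp add: in_tiling_def line_bottom)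
      next
        case False
        then show ?thesis
          using hexchains_subset_line[OF C, of "Suc j"] j nj
          by (auto simp: in_tiling_def algebra_simps)
      qed
      ultimately show ?thesis using True by (simp add: up_in_hexagon_line)
    next
      case False
      have "\<not> in_tiling C Ver m (q + 1)"
      proof (cases "q = -1")
        case True
        \<comment> \<open>Only a vertical lozenge bisected by the top line could reach above it, and
          that line has no gap.\<close>
        then show ?thesis using ends(1) by (simp add: in_tiling_def line_top)
      qed (use False in \<open>auto simp: in_tiling_def\<close>)
      then show ?thesis using False by (auto simp: in_tiling_def up_in_hexagon_line)
    qed
  qed
qed

lemma chain_of_tiling_of_chain:
  assumes C: "C \<in> hexchains"
  shows "chain_of_tiling (tiling_of_chain C) = C"
proof
  fix j
  have fin: "finite (C j)" for j using C by (auto simp: chains_def)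
  show "chain_of_tiling (tiling_of_chain C) j = C j"
  proof (cases "j < a + c")
    case True
    then have "step (C j) (C (Suc j))" using C by (auto simp: chains_def)
    then have "moves (C j) (C (Suc j)) \<subseteq> C j" by (rule step_moves(1)[OF _ fin fin])
    then show ?thesis
      using True by (auto simp: chain_of_tiling_def loz_in_tiling_of_chain in_tiling_def)
  qed (use C in \<open>auto simp: chain_of_tiling_def chains_def\<close>)
qed

context
  fixes T
  assumes T: "lozenge_tiling (hexagon a b c) T"
begin

lemma tiling_dn: "of_bool (loz Lft m q \<in> T) + of_bool (loz Rgt m q \<in> T) + of_bool (loz Ver m q \<in> T)
       = (of_bool (0 \<le> q \<and> q < int a + int c \<and> m \<in> line q) :: int)"
  and tiling_up: "of_bool (loz Lft m q \<in> T) + of_bool (loz Rgt (m - 1) q \<in> T) + of_bool (loz Ver m (q + 1) \<in> T)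
       = (of_bool (0 \<le> q \<and> q < int a + int c \<and> m \<in> line (q + 1)) :: int)"
  using T unfolding lozenge_tiling_iff_covers covers_def dn_in_hexagon_line up_in_hexagon_line by blast+

lemma tiling_Ver_iff:
  assumes "j < a + c"
  shows "loz Ver m (int j) \<in> T \<longleftrightarrow> m \<in> line (int j) \<and> m \<notin> chain_of_tiling T j"
  using tiling_dn[of m "int j"] assms
  by (auto simp: chain_of_tiling_def of_bool_def split: if_splits)

lemma chain_of_tiling_subset:
  assumes "j \<le> a + c"
  shows "chain_of_tiling T j \<subseteq> line (int j)"
proof (cases "j < a + c")
  case True
  show ?thesis
  proof
    fix m assume "m \<in> chain_of_tiling T j"
    then show "m \<in> line (int j)"
      using tiling_dn[of m "int j"] True by (auto simp: chain_of_tiling_def of_bool_def split: if_splits)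
  qed
next
  case False
  then show ?thesis using assms line_bottom by (simp add: chain_of_tiling_def)
qed

text \<open>The equations for the triangles above and below line \<open>j + 1\<close> share the
  vertical lozenge. Eliminating it leaves the conservation law, with the right lozenges as
  moves.\<close>

lemma chain_of_tiling_step:
  assumes j: "j < a + c"
  shows "step (chain_of_tiling T j) (chain_of_tiling T (Suc j))"
    and "moves (chain_of_tiling T j) (chain_of_tiling T (Suc j)) = {m. loz Rgt m (int j) \<in> T}"
proof -
  have fin: "finite (chain_of_tiling T i)" if "i \<le> a + c" for i
    by (rule finite_subset[OF chain_of_tiling_subset[OF that]]) (simp add: line_def)
  have Suc: "of_bool (m \<in> chain_of_tiling T (Suc j)) = (of_bool (loz Lft m (int j) \<in> T) + of_bool (loz Rgt (m - 1) (int j) \<in> T) :: int)" for m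
  proof (cases "Suc j = a + c")
    case True
    then have q: "int j + 1 = int a + int c" by simp
    have "loz Ver m (int j + 1) \<notin> T" using tiling_dn[of m "int j + 1"] q by (auto simp: of_bool_def split: if_splits)
    then show ?thesis
      using tiling_up[of m "int j"] True q j by (simp add: chain_of_tiling_def line_bottom)
  next
    case False
    then show ?thesis
      using tiling_up[of m "int j"] tiling_dn[of m "int j + 1"] j
      by (auto simp: chain_of_tiling_def algebra_simps of_bool_def split: if_splits)
  qed
  have *: "of_bool (m \<in> chain_of_tiling T (Suc j)) =
     (of_bool (m \<in> chain_of_tiling T j) - of_bool (m \<in> {m. loz Rgt m (int j) \<in> T})
       + of_bool (m - 1 \<in> {m. loz Rgt m (int j) \<in> T}) :: int)" for m
    using Suc[of m] tiling_dn[of m "int j"] j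
    by (auto simp: chain_of_tiling_def[of T j] of_bool_def split: if_splits)
  have sub: "{m. loz Rgt m (int j) \<in> T} \<subseteq> chain_of_tiling T j"
    using j by (auto simp: chain_of_tiling_def)
  show "step (chain_of_tiling T j) (chain_of_tiling T (Suc j))"
    and "moves (chain_of_tiling T j) (chain_of_tiling T (Suc j)) = {m. loz Rgt m (int j) \<in> T}"
    using moves_unique[OF fin fin sub *] j by simp_all
qed

lemma chain_of_tiling_chain: "chain_of_tiling T \<in> hexchains"
proof -
  have "finite (chain_of_tiling T j)" for j
  proof (cases "j \<le> a + c")
    case True
    show ?thesis by (rule finite_subset[OF chain_of_tiling_subset[OF True]]) (simp add: line_def)
  qed (simp add: chain_of_tiling_def)
  moreover have "chain_of_tiling T 0 = {0..<int b}"
  proof -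
    \<comment> \<open>The upper half of such a lozenge would be a triangle above the top side, at
      \<open>q = -1\<close>.\<close>
    have "loz Ver m 0 \<notin> T" for m
      using tiling_up[of m "-1"] by (auto simp: of_bool_def split: if_splits)
    then have "m \<in> chain_of_tiling T 0 \<longleftrightarrow> m \<in> line 0" for m
      using tiling_Ver_iff[of 0 m] chain_of_tiling_subset[of 0] pos by auto
    then show ?thesis unfolding line_top by blast
  qed
  ultimately show ?thesis
    using chain_of_tiling_step(1) by (auto simp: chains_def) (auto simp: chain_of_tiling_def)
qed

lemma tiling_of_chain_of_tiling: "tiling_of_chain (chain_of_tiling T) = T"
proof -
  have "in_tiling (chain_of_tiling T) t m q \<longleftrightarrow> loz t m q \<in> T" for t m q
  proof (cases "0 \<le> q \<and> q < int a + int c")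
    case True
    define j where "j = nat q"
    have j: "q = int j" "j < a + c" using True by (auto simp: j_def)
    have "in_tiling (chain_of_tiling T) t m q \<longleftrightarrow> (case t of Rgt \<Rightarrow> loz Rgt m q \<in> T
      | Lft \<Rightarrow> m \<in> chain_of_tiling T j \<and> loz Rgt m q \<notin> T | Ver \<Rightarrow> loz Ver m q \<in> T)"
      using chain_of_tiling_step(2)[OF j(2)] tiling_Ver_iff[OF j(2)] j
      by (cases t) (simp_all add: in_tiling_def)
    also have "\<dots> \<longleftrightarrow> loz t m q \<in> T"
      using tiling_dn[of m q] j by (cases t) (auto simp: chain_of_tiling_def of_bool_def split: if_splits)
    finally show ?thesis .
  next
    case False
    then show ?thesis
      using tiling_dn[of m q] by (cases t) (auto simp: in_tiling_def of_bool_def split: if_splits)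
  qed
  moreover have "\<exists>t m q. L = loz t m q" if "L \<in> T" for L
  proof -
    have "L \<in> lozenges" using that T by (auto simp: lozenge_tiling_def)
    then show ?thesis by (auto simp: lozenges_eq)
  qed
  ultimately show ?thesis unfolding tiling_of_chain_def by blast
qed

text \<open>The right corner has skew coordinate \<open>m + 1\<close>. Passing to real parts
  subtracts \<open>k / 2\<close> from corner and boundary alike, so the distance is an
  integer.\<close>

lemma vertical_positions_eq:
  assumes k: "k < a + c"
  shows "vertical_positions a b c k T =
    (\<lambda>m. real_of_int (m + 1 - max 0 (int k - int a))) ` (line (int k) - chain_of_tiling T k)"
proof -
  have lb: "left_boundary a b c k = real_of_int (max 0 (int k - int a)) - real k / 2"
    using left_boundary_eq[OF pos, of k] k by (simp add: max_def)
  have h: "Im r = line_height k \<longleftrightarrow> dc r = real k" for r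
    by (auto simp: dc_def line_height_def field_simps)
  have re: "Re r = xc r - dc r / 2" for r
    by (simp add: xc_def dc_def field_simps)
  have "vertical_positions a b c k T = {real_of_int (m + 1 - max 0 (int k - int a)) | m. loz Ver m (int k) \<in> T}"
  proof (intro equalityI subsetI)
    fix x assume "x \<in> vertical_positions a b c k T"
    then obtain r where r: "x = Re r - left_boundary a b c k" "vertical_lozenge r \<in> T" "dc r = real k"
      by (auto simp: vertical_positions_def h)
    then have "vertical_lozenge r \<in> lozenges" using T by (auto simp: lozenge_tiling_def)
    then obtain m q where mq: "vertical_lozenge r = loz Ver m q" "xc r = of_int m + 1" "dc r = of_int q"
      by (rule vertical_lozenge_in_lozenges)
    then have "q = int k" using r(3) by linarith
    then have "loz Ver m (int k) \<in> T" using mq(1) r(2) by simp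
    moreover have "x = real_of_int (m + 1 - max 0 (int k - int a))"
      using mq r by (simp add: re lb)
    ultimately show "x \<in> {real_of_int (m + 1 - max 0 (int k - int a)) | m. loz Ver m (int k) \<in> T}"
      by blast
  next
    fix x assume "x \<in> {real_of_int (m + 1 - max 0 (int k - int a)) | m. loz Ver m (int k) \<in> T}"
    then obtain m where m: "x = real_of_int (m + 1 - max 0 (int k - int a))" "loz Ver m (int k) \<in> T" by blast
    define r where "r = pt (of_int m + 1) (of_int (int k))"
    have "vertical_lozenge r \<in> T" using m by (simp add: r_def loz_Ver_eq_vertical)
    moreover have "Im r = line_height k" by (simp add: h) (simp add: r_def)
    moreover have "x = Re r - left_boundary a b c k" unfolding re lb by (simp add: r_def m)
    ultimately show "x \<in> vertical_positions a b c k T" unfolding vertical_positions_def by blast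
  qed
  then show ?thesis using tiling_Ver_iff[OF k] by auto
qed

end

text \<open>\<open>S\<close> turns positions into left end points: minus 1 from the right corner to
  the left one, plus the coordinate of the left boundary. Prescribing the gaps fixes the occupied
  set at line \<open>k\<close>, which has \<open>b\<close> elements.\<close>

theorem card_tilings:
  assumes k: "k < a + c" and P: "P \<subseteq> {1..int (card (line (int k)))}" "card (line (int k)) = b + card P"
  defines "S \<equiv> (\<lambda>x. x - 1 + max 0 (int k - int a)) ` P"
  shows "real (card {T. lozenge_tiling (hexagon a b c) T \<and> vertical_positions a b c k T = real_of_int ` P})
    = Vset ({0..<int b + int k} - (line (int k) - S)) * Vset ({int k - int a..<int b + int c} - (line (int k) - S))"
proof -
  let ?l = "max 0 (int k - int a)"
  have inj: "inj (\<lambda>m. real_of_int (m + 1 - ?l))" by (auto intro!: injI)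
  have PS: "real_of_int ` P = (\<lambda>m. real_of_int (m + 1 - ?l)) ` S"
    unfolding S_def image_image by simp
  have "line (int k) = {?l..<?l + int (card (line (int k)))}"
    using k by (auto simp: line_def)
  moreover have "S \<subseteq> {?l..<?l + int (card (line (int k)))}"
    using P(1) unfolding S_def by force
  ultimately have S: "S \<subseteq> line (int k)" by simp
  have vp: "vertical_positions a b c k T = real_of_int ` P \<longleftrightarrow> chain_of_tiling T k = line (int k) - S"
    if T: "lozenge_tiling (hexagon a b c) T" for T
  proof -
    have "vertical_positions a b c k T = real_of_int ` P \<longleftrightarrow> line (int k) - chain_of_tiling T k = S"
      unfolding vertical_positions_eq[OF T k] PS inj_image_eq_iff[OF inj] ..
    then show ?thesis using S chain_of_tiling_subset[OF T, of k] k by auto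
  qed
  have "bij_betw chain_of_tiling
      {T. lozenge_tiling (hexagon a b c) T \<and> vertical_positions a b c k T = real_of_int ` P}
      {C \<in> hexchains. C k = line (int k) - S}"
  proof (rule bij_betw_byWitness[where f' = tiling_of_chain])
    show "tiling_of_chain ` {C \<in> hexchains. C k = line (int k) - S} \<subseteq>
        {T. lozenge_tiling (hexagon a b c) T \<and> vertical_positions a b c k T = real_of_int ` P}"
    proof (rule image_subsetI)
      fix C assume "C \<in> {C \<in> hexchains. C k = line (int k) - S}"
      then have C: "C \<in> hexchains" "C k = line (int k) - S" by simp_all
      show "tiling_of_chain C \<in> {T. lozenge_tiling (hexagon a b c) T \<and> vertical_positions a b c k T = real_of_int ` P}"
        using vp[OF tiling_of_chain_tiling[OF C(1)]] tiling_of_chain_tiling[OF C(1)] C(2)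
        by (simp add: chain_of_tiling_of_chain[OF C(1)])
    qed
  qed (auto simp: tiling_of_chain_of_tiling chain_of_tiling_of_chain vp chain_of_tiling_chain)
  then have "card {T. lozenge_tiling (hexagon a b c) T \<and> vertical_positions a b c k T = real_of_int ` P}
      = card {C \<in> hexchains. C k = line (int k) - S}"
    by (rule bij_betw_same_card)
  moreover have "card (line (int k) - S) = b"
  proof -
    have "card S = card P" unfolding S_def by (rule card_image) (auto intro!: inj_onI)
    moreover have "finite S" using S finite_subset by (auto simp: line_def)
    ultimately show ?thesis using S P(2) by (simp add: card_Diff_subset)
  qed
  moreover have "line (int k) - S \<subseteq> {0..<int b + int k}" "line (int k) - S \<subseteq> {int k - int a..<int b + int c}"
    by (auto simp: line_def)
  ultimately show ?thesis
    using card_chains_hexagon[of "line (int k) - S" b k a c] k by simp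
qed

end

theorem theorem2p2:
  fixes a b c k :: nat and p :: "int list"
  assumes "a > 0" and "b > 0" and "c > 0"
    and "length p = min k (min a c)"
    and "sorted_wrt (<) p"
    and "set p \<subseteq> {1..int b + int (min k a)}"
  shows "(k < min a c \<longrightarrow>
           real (card {T. lozenge_tiling (hexagon a b c) T \<and>
                          vertical_positions a b c k T = real_of_int ` set p}) =
             V p *
             V ([1..int a - int k] @ map (\<lambda>x. int a - int k + x) p @
                [int a + int b + 1..int a + int b + int c - int k])) \<and>
         (a \<le> c \<and> a \<le> k \<and> 2 * k \<le> a + c \<longrightarrow>
           real (card {T. lozenge_tiling (hexagon a b c) T \<and>
                          vertical_positions a b c k T = real_of_int ` set p}) =
             V ([1..int k - int a] @ map (\<lambda>x. int k - int a + x) p) *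
             V (p @ [int a + int b + 1..int a + int b + int c - int k]))"
proof -
  have sorted_upto: "sorted_wrt (<) [i..j]" for i j :: int
    by (simp add: strict_sorted_iff)
  \<comment> \<open>By translation invariance each argument list need only be a translate of a gap
    set: by 1 for the window starting at 0, by \<open>a - k + 1\<close> for the one starting at
    \<open>k - a\<close>.\<close>
  have shift: "V xs = Vset X" if "sorted_wrt (<) xs" "set xs = (+) t ` X" for xs X t
  proof -
    have "finite X" using that(2) by (metis finite_imageD inj_on_add List.finite_set)
    then show ?thesis using V_eq_Vset[OF that(1)] that(2) Vset_shift by simp
  qed
  have card_p: "card (set p) = length p"
    using assms(5) by (simp add: distinct_card strict_sorted_iff)
  have p_bounds: "1 \<le> x \<and> x \<le> int b + int (min k a)" if "x \<in> set p" for x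
    using that assms(6) by auto
  have im: "x \<in> (+) t ` X \<longleftrightarrow> x - t \<in> X" for x t :: int and X
    by (auto intro: image_eqI[of _ _ "x - t"])
  have im': "x \<in> (\<lambda>x. x - 1 + t) ` X \<longleftrightarrow> x + 1 - t \<in> X" for x t :: int and X
    by (auto intro: image_eqI[of _ _ "x + 1 - t"])
  have cancel: "x - (s + 1) + 1 - 0 = x - s" "x - 1 + 1 - s = x - s"
    "x - (int a - int k + 1) + 1 - (int k - int a) = x" for x s :: int
    by simp_all
  show ?thesis
  proof (intro conjI impI)
    assume k: "k < min a c"
    let ?S = "(\<lambda>x. x - 1 + max 0 (int k - int a)) ` set p"
    \<comment> \<open>Here the line fills the upper window, while the lower one exceeds it by
      \<open>a - k\<close> on the left and \<open>c - k\<close> on the right.\<close>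
    have l: "line a b c (int k) = {0..<int b + int k}" using k by (auto simp: line_def[OF assms(1-3)])
    have m: "max 0 (int k - int a) = 0" using k by simp
    have "V p = Vset ({0..<int b + int k} - ({0..<int b + int k} - ?S))"
    proof (rule shift[where t = 1])
      show "set p = (+) 1 ` ({0..<int b + int k} - ({0..<int b + int k} - ?S))"
      proof (rule Set.set_eqI)
        fix x
        show "x \<in> set p \<longleftrightarrow> x \<in> (+) 1 ` ({0..<int b + int k} - ({0..<int b + int k} - ?S))"
          using p_bounds[of x] k by (auto simp: im im' m)
      qed
    qed (rule assms(5))
    moreover have "V ([1..int a - int k] @ map (\<lambda>x. int a - int k + x) p @
                [int a + int b + 1..int a + int b + int c - int k])
       = Vset ({int k - int a..<int b + int c} - ({0..<int b + int k} - ?S))"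
    proof (rule shift[where t = "int a - int k + 1"])
      show "sorted_wrt (<) ([1..int a - int k] @ map (\<lambda>x. int a - int k + x) p @
                [int a + int b + 1..int a + int b + int c - int k])"
        using assms(5) k by (auto simp: sorted_wrt_append sorted_wrt_map sorted_upto dest!: p_bounds)
      show "set ([1..int a - int k] @ map (\<lambda>x. int a - int k + x) p @
                [int a + int b + 1..int a + int b + int c - int k])
         = (+) (int a - int k + 1) ` ({int k - int a..<int b + int c} - ({0..<int b + int k} - ?S))"
      proof (rule Set.set_eqI)
        fix x
        show "x \<in> set ([1..int a - int k] @ map (\<lambda>x. int a - int k + x) p @
                [int a + int b + 1..int a + int b + int c - int k])
         \<longleftrightarrow> x \<in> (+) (int a - int k + 1) ` ({int k - int a..<int b + int c} - ({0..<int b + int k} - ?S))"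
          using p_bounds[of x] p_bounds[of "x - (int a - int k)"] p_bounds[of "x - (int k - int a)"] k
          unfolding set_append set_map Un_iff im Diff_iff im' m cancel by auto
      qed
    qed
    ultimately show "real (card {T. lozenge_tiling (hexagon a b c) T \<and>
                          vertical_positions a b c k T = real_of_int ` set p}) =
             V p *
             V ([1..int a - int k] @ map (\<lambda>x. int a - int k + x) p @
                [int a + int b + 1..int a + int b + int c - int k])"
      using card_tilings[OF assms(1-3), of k "set p"] assms(4,6) k card_p by (simp add: l)
  next
    assume k: "a \<le> c \<and> a \<le> k \<and> 2 * k \<le> a + c"
    let ?S = "(\<lambda>x. x - 1 + max 0 (int k - int a)) ` set p"
    \<comment> \<open>The bounds give \<open>k\<close> \<le> \<open>c\<close>: the upper window
      exceeds the line by \<open>k - a\<close> on the left, the lower one by \<open>c - k\<close> on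
      the right.\<close>
    have l: "line a b c (int k) = {int k - int a..<int b + int k}" using k by (auto simp: line_def[OF assms(1-3)])
    have m: "max 0 (int k - int a) = int k - int a" using k by simp
    have "V ([1..int k - int a] @ map (\<lambda>x. int k - int a + x) p)
       = Vset ({0..<int b + int k} - ({int k - int a..<int b + int k} - ?S))"
    proof (rule shift[where t = 1])
      show "sorted_wrt (<) ([1..int k - int a] @ map (\<lambda>x. int k - int a + x) p)"
        using assms(5) k by (auto simp: sorted_wrt_append sorted_wrt_map sorted_upto dest!: p_bounds)
      show "set ([1..int k - int a] @ map (\<lambda>x. int k - int a + x) p)
         = (+) 1 ` ({0..<int b + int k} - ({int k - int a..<int b + int k} - ?S))"
      proof (rule Set.set_eqI)
        fix x
        show "x \<in> set ([1..int k - int a] @ map (\<lambda>x. int k - int a + x) p)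
         \<longleftrightarrow> x \<in> (+) 1 ` ({0..<int b + int k} - ({int k - int a..<int b + int k} - ?S))"
          using p_bounds[of x] p_bounds[of "x - (int a - int k)"] p_bounds[of "x - (int k - int a)"] k
          unfolding set_append set_map Un_iff im Diff_iff im' m cancel by auto
      qed
    qed
    moreover have "V (p @ [int a + int b + 1..int a + int b + int c - int k])
       = Vset ({int k - int a..<int b + int c} - ({int k - int a..<int b + int k} - ?S))"
    proof (rule shift[where t = "int a - int k + 1"])
      show "sorted_wrt (<) (p @ [int a + int b + 1..int a + int b + int c - int k])"
        using assms(5) k by (auto simp: sorted_wrt_append sorted_upto dest!: p_bounds)
      show "set (p @ [int a + int b + 1..int a + int b + int c - int k])
         = (+) (int a - int k + 1) ` ({int k - int a..<int b + int c} - ({int k - int a..<int b + int k} - ?S))"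
      proof (rule Set.set_eqI)
        fix x
        show "x \<in> set (p @ [int a + int b + 1..int a + int b + int c - int k])
         \<longleftrightarrow> x \<in> (+) (int a - int k + 1) ` ({int k - int a..<int b + int c} - ({int k - int a..<int b + int k} - ?S))"
          using p_bounds[of x] p_bounds[of "x - (int a - int k)"] p_bounds[of "x - (int k - int a)"] k
          unfolding set_append set_map Un_iff im Diff_iff im' m cancel by auto
      qed
    qed
    ultimately show "real (card {T. lozenge_tiling (hexagon a b c) T \<and>
                          vertical_positions a b c k T = real_of_int ` set p}) =
             V ([1..int k - int a] @ map (\<lambda>x. int k - int a + x) p) *
             V (p @ [int a + int b + 1..int a + int b + int c - int k])"
      using card_tilings[OF assms(1-3), of k "set p"] assms(1,3,4,6) k card_p by (simp add: l)
  qed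
qed

end
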